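(* For every integer $\omega$ and every $\mathsf{MSO}_1$-sentence $\psi$ on graphs, there is a proof labeling scheme $(\mathsf{P},\mathsf{V})$ of size $O(\log n)$ for the class of connected graphs that have locally verifiable treewidth at most $\omega$ and satisfy $\psi$.
   Context: An $\mathsf{MSO}_1$-sentence on graphs is a monadic second-order sentence (quantifiers over vertices and over sets of vertices) over the vocabulary consisting of one binary predicate $\mathsf{edge}$, interpreted on the structure with universe $V(G)$ and $\mathsf{edge}(u,v)$ iff $uv\in E(G)$. An elimination tree of a connected graph $G$ is a rooted tree $F$ with $V(F)=V(G)$ such that for every edge $uv$ of $G$ one endpoint is an ancestor of the other in $F$; with $F_v$ the subtree rooted at $v$ and $\mathsf{str}(v)$ the set of $v$ and all strict ancestors of $v$ with a neighbour in $V(F_v)$, the width of $F$ is $\max_v|\mathsf{str}(v)|-1$. An oriented path system over $G$ is a set of oriented paths each obtained by orienting a path of $G$; the congestion of a vertex $v$ is the number of its paths having $v$ as starting or internal vertex, and the congestion of the system is the maximum over vertices; it witnesses $F$ if for every non-root $v$ with parent $\mathsf{p}(v)$, either $v\mathsf{p}(v)\in E(G)$ or the system contains a path oriented from $v$ to $\mathsf{p}(v)$. A graph has locally verifiable treewidth at most $k$ if each component has an elimination tree of width at most $k$ and a witnessing oriented path system of congestion at most $k$. Proof labeling scheme: vertices have unique identifiers in $\{1,\dots,n\}$; the prover assigns binary labels; the verifier at $v$ sees only $\mathsf{id}(v)$ and $(\mathsf{id}(w),\varphi(w))$ for $w\in N[v]$ and outputs Yes/No; completeness: on graphs in the class the prover's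 labels make all vertices accept; soundness: on graphs outside it, every labeling makes some vertex reject; size $O(\log n)$: labels have length $O(\log n)$. *)

theory Defs
  imports Complex_Main
begin

definition simple_graph :: "'v set \<Rightarrow> ('v \<Rightarrow> 'v \<Rightarrow> bool) \<Rightarrow> bool" where
  "simple_graph V E \<longleftrightarrow> finite V \<and> V \<noteq> {} \<and>
     (\<forall>u v. E u v \<longrightarrow> u \<in> V \<and> v \<in> V \<and> u \<noteq> v \<and> E v u)"

definition reach :: "'v set \<Rightarrow> ('v \<Rightarrow> 'v \<Rightarrow> bool) \<Rightarrow> 'v \<Rightarrow> 'v \<Rightarrow> bool" where
  "reach V E = (\<lambda>u v. u \<in> V \<and> v \<in> V \<and> E u v)\<^sup>*\<^sup>*"

definition connected_graph :: "'v set \<Rightarrow> ('v \<Rightarrow> 'v \<Rightarrow> bool) \<Rightarrow> bool" where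
  "connected_graph V E \<longleftrightarrow> V \<noteq> {} \<and> (\<forall>u\<in>V. \<forall>v\<in>V. reach V E u v)"

definition component :: "'v set \<Rightarrow> ('v \<Rightarrow> 'v \<Rightarrow> bool) \<Rightarrow> 'v \<Rightarrow> 'v set" where
  "component V E v = {w \<in> V. reach V E v w}"

definition restrict_edges :: "'v set \<Rightarrow> ('v \<Rightarrow> 'v \<Rightarrow> bool) \<Rightarrow> ('v \<Rightarrow> 'v \<Rightarrow> bool)" where
  "restrict_edges C E = (\<lambda>u v. u \<in> C \<and> v \<in> C \<and> E u v)"

definition closed_nbhd :: "'v set \<Rightarrow> ('v \<Rightarrow> 'v \<Rightarrow> bool) \<Rightarrow> 'v \<Rightarrow> 'v set" where
  "closed_nbhd V E v = {w \<in> V. w = v \<or> E v w}"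

text \<open>Vertex variables and set variables are both indexed by naturals (separate name spaces).\<close>

datatype mso =
    Edge nat nat
  | Eq nat nat
  | Mem nat nat
  | Neg mso
  | Conj mso mso
  | Disj mso mso
  | ExV nat mso
  | AllV nat mso
  | ExS nat mso
  | AllS nat mso

fun fvV :: "mso \<Rightarrow> nat set" where
  "fvV (Edge x y) = {x, y}"
| "fvV (Eq x y) = {x, y}"
| "fvV (Mem x X) = {x}"
| "fvV (Neg \<phi>) = fvV \<phi>"
| "fvV (Conj \<phi> \<psi>) = fvV \<phi> \<union> fvV \<psi>"
| "fvV (Disj \<phi> \<psi>) = fvV \<phi> \<union> fvV \<psi>"
| "fvV (ExV x \<phi>) = fvV \<phi> - {x}"
| "fvV (AllV x \<phi>) = fvV \<phi> - {x}"
| "fvV (ExS X \<phi>) = fvV \<phi>"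
| "fvV (AllS X \<phi>) = fvV \<phi>"

fun fvS :: "mso \<Rightarrow> nat set" where
  "fvS (Edge x y) = {}"
| "fvS (Eq x y) = {}"
| "fvS (Mem x X) = {X}"
| "fvS (Neg \<phi>) = fvS \<phi>"
| "fvS (Conj \<phi> \<psi>) = fvS \<phi> \<union> fvS \<psi>"
| "fvS (Disj \<phi> \<psi>) = fvS \<phi> \<union> fvS \<psi>"
| "fvS (ExV x \<phi>) = fvS \<phi>"
| "fvS (AllV x \<phi>) = fvS \<phi>"
| "fvS (ExS X \<phi>) = fvS \<phi> - {X}"
| "fvS (AllS X \<phi>) = fvS \<phi> - {X}"

definition mso_sentence :: "mso \<Rightarrow> bool" where
  "mso_sentence \<phi> \<longleftrightarrow> fvV \<phi> = {} \<and> fvS \<phi> = {}"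

fun sat :: "'v set \<Rightarrow> ('v \<Rightarrow> 'v \<Rightarrow> bool) \<Rightarrow> (nat \<Rightarrow> 'v) \<Rightarrow> (nat \<Rightarrow> 'v set) \<Rightarrow> mso \<Rightarrow> bool" where
  "sat V E I J (Edge x y) = E (I x) (I y)"
| "sat V E I J (Eq x y) = (I x = I y)"
| "sat V E I J (Mem x X) = (I x \<in> J X)"
| "sat V E I J (Neg \<phi>) = (\<not> sat V E I J \<phi>)"
| "sat V E I J (Conj \<phi> \<psi>) = (sat V E I J \<phi> \<and> sat V E I J \<psi>)"
| "sat V E I J (Disj \<phi> \<psi>) = (sat V E I J \<phi> \<or> sat V E I J \<psi>)"
| "sat V E I J (ExV x \<phi>) = (\<exists>a\<in>V. sat V E (I(x := a)) J \<phi>)"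
| "sat V E I J (AllV x \<phi>) = (\<forall>a\<in>V. sat V E (I(x := a)) J \<phi>)"
| "sat V E I J (ExS X \<phi>) = (\<exists>A. A \<subseteq> V \<and> sat V E I (J(X := A)) \<phi>)"
| "sat V E I J (AllS X \<phi>) = (\<forall>A. A \<subseteq> V \<longrightarrow> sat V E I (J(X := A)) \<phi>)"

text \<open>Satisfaction of a sentence (the assignments are irrelevant for sentences).\<close>
definition models :: "'v set \<Rightarrow> ('v \<Rightarrow> 'v \<Rightarrow> bool) \<Rightarrow> mso \<Rightarrow> bool" where
  "models V E \<phi> \<longleftrightarrow> sat V E (\<lambda>_. undefined) (\<lambda>_. {}) \<phi>"

text \<open>A rooted tree on vertex set C is given by a root r and a parent function p
  (p v is the parent of v for v \<noteq> r; p r is irrelevant).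
  anc C r p u v: u is an ancestor of v or u = v.\<close>

inductive anc :: "'v set \<Rightarrow> 'v \<Rightarrow> ('v \<Rightarrow> 'v) \<Rightarrow> 'v \<Rightarrow> 'v \<Rightarrow> bool"
  for C r p where
  anc_refl: "anc C r p v v"
| anc_step: "v \<noteq> r \<Longrightarrow> anc C r p u (p v) \<Longrightarrow> anc C r p u v"

definition rooted_tree :: "'v set \<Rightarrow> 'v \<Rightarrow> ('v \<Rightarrow> 'v) \<Rightarrow> bool" where
  "rooted_tree C r p \<longleftrightarrow> r \<in> C \<and> (\<forall>v\<in>C - {r}. p v \<in> C) \<and> (\<forall>v\<in>C. anc C r p r v)"

definition subtree :: "'v set \<Rightarrow> 'v \<Rightarrow> ('v \<Rightarrow> 'v) \<Rightarrow> 'v \<Rightarrow> 'v set" where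
  "subtree C r p v = {w \<in> C. anc C r p v w}"

definition elimination_tree :: "'v set \<Rightarrow> ('v \<Rightarrow> 'v \<Rightarrow> bool) \<Rightarrow> 'v \<Rightarrow> ('v \<Rightarrow> 'v) \<Rightarrow> bool" where
  "elimination_tree C E r p \<longleftrightarrow> rooted_tree C r p \<and>
     (\<forall>u\<in>C. \<forall>v\<in>C. E u v \<longrightarrow> anc C r p u v \<or> anc C r p v u)"

definition strv :: "'v set \<Rightarrow> ('v \<Rightarrow> 'v \<Rightarrow> bool) \<Rightarrow> 'v \<Rightarrow> ('v \<Rightarrow> 'v) \<Rightarrow> 'v \<Rightarrow> 'v set" where
  "strv C E r p v = insert v {u \<in> C. anc C r p u v \<and> u \<noteq> v \<and> (\<exists>w\<in>subtree C r p v. E u w)}"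

definition width_le :: "'v set \<Rightarrow> ('v \<Rightarrow> 'v \<Rightarrow> bool) \<Rightarrow> 'v \<Rightarrow> ('v \<Rightarrow> 'v) \<Rightarrow> int \<Rightarrow> bool" where
  "width_le C E r p k \<longleftrightarrow> (\<forall>v\<in>C. int (card (strv C E r p v)) - 1 \<le> k)"

definition oriented_path :: "'v set \<Rightarrow> ('v \<Rightarrow> 'v \<Rightarrow> bool) \<Rightarrow> 'v list \<Rightarrow> bool" where
  "oriented_path C E P \<longleftrightarrow> P \<noteq> [] \<and> distinct P \<and> set P \<subseteq> C \<and>
     (\<forall>i. Suc i < length P \<longrightarrow> E (P ! i) (P ! Suc i))"

definition path_system :: "'v set \<Rightarrow> ('v \<Rightarrow> 'v \<Rightarrow> bool) \<Rightarrow> 'v list set \<Rightarrow> bool" where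
  "path_system C E S \<longleftrightarrow> (\<forall>P\<in>S. oriented_path C E P)"

text \<open>Congestion of v: number of paths with v as starting or internal vertex,
  i.e. v occurring in the path other than as its last vertex.\<close>
definition congestion_at :: "'v list set \<Rightarrow> 'v \<Rightarrow> nat" where
  "congestion_at S v = card {P \<in> S. v \<in> set (butlast P)}"

definition congestion_le :: "'v set \<Rightarrow> 'v list set \<Rightarrow> int \<Rightarrow> bool" where
  "congestion_le C S k \<longleftrightarrow> (\<forall>v\<in>C. int (congestion_at S v) \<le> k)"

definition witnesses :: "'v set \<Rightarrow> ('v \<Rightarrow> 'v \<Rightarrow> bool) \<Rightarrow> 'v list set \<Rightarrow> 'v \<Rightarrow> ('v \<Rightarrow> 'v) \<Rightarrow> bool" where
  "witnesses C E S r p \<longleftrightarrow>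
     (\<forall>v\<in>C - {r}. E v (p v) \<or> (\<exists>P\<in>S. hd P = v \<and> last P = p v))"

definition lv_treewidth_le :: "'v set \<Rightarrow> ('v \<Rightarrow> 'v \<Rightarrow> bool) \<Rightarrow> int \<Rightarrow> bool" where
  "lv_treewidth_le V E k \<longleftrightarrow>
     (\<forall>x\<in>V. let C = component V E x; EC = restrict_edges C E in
        \<exists>r p S. elimination_tree C EC r p \<and> width_le C EC r p k \<and>
                path_system C EC S \<and> congestion_le C S k \<and> witnesses C EC S r p)"

definition id_assignment :: "'v set \<Rightarrow> ('v \<Rightarrow> nat) \<Rightarrow> bool" where
  "id_assignment V ident \<longleftrightarrow> bij_betw ident V {1..card V}"

definition view :: "'v set \<Rightarrow> ('v \<Rightarrow> 'v \<Rightarrow> bool) \<Rightarrow> ('v \<Rightarrow> nat) \<Rightarrow> ('v \<Rightarrow> bool list) \<Rightarrow> 'v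
                    \<Rightarrow> nat \<times> (nat \<times> bool list) set" where
  "view V E ident L v = (ident v, (\<lambda>w. (ident w, L w)) ` closed_nbhd V E v)"

definition PLS_log :: "('v set \<Rightarrow> ('v \<Rightarrow> 'v \<Rightarrow> bool) \<Rightarrow> bool)
      \<Rightarrow> ('v set \<Rightarrow> ('v \<Rightarrow> 'v \<Rightarrow> bool) \<Rightarrow> ('v \<Rightarrow> nat) \<Rightarrow> 'v \<Rightarrow> bool list)
      \<Rightarrow> (nat \<times> (nat \<times> bool list) set \<Rightarrow> bool) \<Rightarrow> bool" where
  "PLS_log Cls Prv Ver \<longleftrightarrow>
     \<comment> \<open>completeness\<close>
     (\<forall>V E ident. simple_graph V E \<and> Cls V E \<and> id_assignment V ident \<longrightarrow>
        (\<forall>v\<in>V. Ver (view V E ident (Prv V E ident) v))) \<and>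
     \<comment> \<open>soundness\<close>
     (\<forall>V E ident L. simple_graph V E \<and> \<not> Cls V E \<and> id_assignment V ident \<longrightarrow>
        (\<exists>v\<in>V. \<not> Ver (view V E ident L v))) \<and>
     \<comment> \<open>size O(log n)\<close>
     (\<exists>c::real. \<forall>V E ident. simple_graph V E \<and> Cls V E \<and> id_assignment V ident \<longrightarrow>
        (\<forall>v\<in>V. real (length (Prv V E ident v)) \<le> c * log 2 (real (card V)) + c))"

end

theory Submission
  imports Defs "HOL-Library.Nat_Bijection"
begin

text \<open>
  Colour the vertices of an elimination tree of width at most \<open>k\<close> greedily from the root with
  \<open>k + 1\<close> colours so that \<open>v\<close> differs from the rest of \<open>str(v)\<close>. The strict ancestors of \<open>v\<close> that
  matter below \<open>v\<close> are then addressed by colours, the graph becomes a tree over a finite alphabet,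
  and an \<open>MSO\<^sub>1\<close> sentence is decided by a finite-state bottom-up run, obtained by induction on the
  formula with a powerset construction for the quantifiers. The label of \<open>v\<close> is a record (identifier,
  parent, depth, colour, coloured ancestors, state); for a tree edge \<open>v p(v)\<close> that is not an edge of the
  graph, the record travels along the witnessing path, so that every vertex sees the records of all of
  its children and can check the tree structure and the run. Congestion at most \<open>k\<close> bounds the number of
  records stored at a vertex. Distances to the vertex with identifier 1 certify connectivity: a second
  component would lack that vertex.
\<close>

section \<open>Finite-state runs on coloured elimination trees\<close>

text \<open>The class fixes its bound exactly, so accepted labels must yield width and congestion at
  most the same \<open>k\<close>, not merely a function of it. Two counts achieve this. Of the
  \<open>k + 1\<close> colour slots of \<open>v\<close>, the one for its own colour is empty, so at
  most \<open>k\<close> strict ancestors are named. Each path leaving or crossing a vertex is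
  charged to an item stored there, identified by the start of the path, and at most \<open>k\<close>
  items are stored. The slots need not equal str(v); they only have to cover it, which follows from
  two local rules: each edge is named in a slot of one of its ends, and a filled slot either names
  the parent, under the parent's colour, or is copied from the parent. Degrees are unbounded, so a
  transition receives the set of children rather than a tuple of states. Transitions are
  deterministic, so the states in accepted labels are forced and the root state can be trusted;
  nondeterminism is confined to the powerset construction.\<close>

locale rooted =
  fixes V :: "'v set" and r :: 'v and p :: "'v \<Rightarrow> 'v" and d :: "'v \<Rightarrow> nat"
  assumes fin: "finite V" and root_in: "r \<in> V"
    and depth_root: "d r = 0"
    and par_in: "v \<in> V \<Longrightarrow> v \<noteq> r \<Longrightarrow> p v \<in> V"
    and depth_par: "v \<in> V \<Longrightarrow> v \<noteq> r \<Longrightarrow> d v = Suc (d (p v))"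
begin

definition children :: "'v \<Rightarrow> 'v set" where
  "children v = {x \<in> V. x \<noteq> r \<and> p x = v}"

abbreviation below :: "'v \<Rightarrow> 'v \<Rightarrow> bool" where
  "below \<equiv> anc V r p"

lemma bottom_up:
  assumes v: "v \<in> V" and step: "\<And>v. v \<in> V \<Longrightarrow> (\<And>x. x \<in> children v \<Longrightarrow> Q x) \<Longrightarrow> Q v"
  shows "Q v"
  using v
proof (induction "Max (d ` V) - d v" arbitrary: v rule: less_induct)
  case less
  show ?case
  proof (rule step[OF less.prems])
    fix x assume x: "x \<in> children v"
    then have "x \<in> V" "d x = Suc (d v)" using depth_par by (auto simp: children_def)
    moreover have "d x \<le> Max (d ` V)" using \<open>x \<in> V\<close> fin by simp
    ultimately show "Q x" using less.hyps[of x] by simp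
  qed
qed

lemma top_down:
  assumes v: "v \<in> V" and root: "Q r"
    and step: "\<And>v. v \<in> V \<Longrightarrow> v \<noteq> r \<Longrightarrow> Q (p v) \<Longrightarrow> Q v"
  shows "Q v"
  using v
proof (induction "d v" arbitrary: v)
  case 0
  then show ?case using depth_par root by (cases "v = r") auto
next
  case (Suc n)
  then show ?case using depth_par par_in root step by (cases "v = r") auto
qed

lemma anc_depth: "below u v \<Longrightarrow> v \<in> V \<Longrightarrow> u \<in> V \<and> (u = v \<or> d u < d v)"
  by (induction rule: anc.induct) (use par_in depth_par in force)+

lemma anc_trans: "below v w \<Longrightarrow> below u v \<Longrightarrow> below u w"
  by (induction rule: anc.induct) (auto intro: anc.intros)

lemma root_anc: "v \<in> V \<Longrightarrow> below r v"
  by (rule top_down) (auto intro: anc.intros)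

lemma anc_child: "x \<in> children v \<Longrightarrow> below v x"
  by (auto simp: children_def intro: anc.intros)

lemma anc_cases_top:
  "below v w \<Longrightarrow> w \<in> V \<Longrightarrow> w = v \<or> (\<exists>x\<in>children v. below x w)"
proof (induction rule: anc.induct)
  case (anc_step w v)
  then have "p w \<in> V" using par_in by auto
  from anc_step.IH[OF this] show ?case
  proof (elim disjE bexE, goal_cases)
    case 1 then show ?case using anc_step by (auto simp: children_def intro: anc.intros)
  next
    case (2 x) then show ?case using anc_step by (auto intro: anc.intros)
  qed
qed auto

lemma anc_iff_top:
  "v \<in> V \<Longrightarrow> w \<in> V \<Longrightarrow> below v w \<longleftrightarrow> w = v \<or> (\<exists>x\<in>children v. below x w)"
  using anc_cases_top anc_child anc_trans anc.anc_refl by metis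

lemma rooted_tree: "rooted_tree V r p"
  unfolding rooted_tree_def using root_in par_in root_anc by auto

end

section \<open>Coloured elimination trees and their runs\<close>

text \<open>\<open>\<kappa>\<close> assigns identifiers, and \<open>a v c\<close> is the identifier of the ancestor of colour \<open>c\<close> in
  \<open>str(v)\<close>, or 0 if there is none.\<close>

locale etree = rooted V r p d
  for k :: nat and V :: "'v set" and E :: "'v \<Rightarrow> 'v \<Rightarrow> bool" and \<kappa> :: "'v \<Rightarrow> nat"
    and r :: 'v and p :: "'v \<Rightarrow> 'v" and d :: "'v \<Rightarrow> nat" and col :: "'v \<Rightarrow> nat"
    and a :: "'v \<Rightarrow> nat \<Rightarrow> nat" +
  assumes key_inj: "inj_on \<kappa> V" and key_nz: "v \<in> V \<Longrightarrow> \<kappa> v \<noteq> 0"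
    and edge_in: "E u v \<Longrightarrow> u \<in> V \<and> v \<in> V \<and> E v u"
    and col_le: "v \<in> V \<Longrightarrow> col v \<le> k"
    and a_root: "c \<le> k \<Longrightarrow> a r c = 0"
    and a_col: "v \<in> V \<Longrightarrow> a v (col v) = 0"
    and a_step: "v \<in> V \<Longrightarrow> v \<noteq> r \<Longrightarrow> c \<le> k \<Longrightarrow> a v c \<noteq> 0 \<Longrightarrow>
        a v c = \<kappa> (p v) \<and> c = col (p v) \<or> a v c = a (p v) c"
    and edge_a: "E u v \<Longrightarrow> (\<exists>c\<le>k. a v c = \<kappa> u) \<or> (\<exists>c\<le>k. a u c = \<kappa> v)"
begin

text \<open>What a transition at \<open>v\<close> learns about edges. By \<open>edge_up\<close>
  every edge shows up at its deeper end, so looking only upwards loses none.\<close>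

definition up_cols :: "'v \<Rightarrow> nat set" where
  "up_cols v = {c. c \<le> k \<and> (\<exists>w. E v w \<and> a v c = \<kappa> w)}"

text \<open>Child states reach \<open>f\<close> through the set of the children's keys and the whole
  assignment; \<open>recognizable\<close> then requires that \<open>f\<close> look at the assignment
  only on these keys. One transition function thus serves vertices with any number of
  children.\<close>

definition run :: "(nat \<Rightarrow> nat set \<Rightarrow> nat set \<Rightarrow> nat set \<Rightarrow> (nat \<Rightarrow> nat) \<Rightarrow> nat) \<Rightarrow> ('v \<Rightarrow> nat set)
    \<Rightarrow> (nat \<Rightarrow> nat) \<Rightarrow> bool" where
  "run f M \<rho> \<longleftrightarrow> (\<forall>v\<in>V. \<rho> (\<kappa> v) = f (col v) (up_cols v) (M v) (\<kappa> ` children v) \<rho>)"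

lemma key_eq: "u \<in> V \<Longrightarrow> v \<in> V \<Longrightarrow> \<kappa> u = \<kappa> v \<longleftrightarrow> u = v"
  using key_inj by (auto dest: inj_onD)

text \<open>A filled slot is copied downwards from the vertex where it was created, and there it
  names the parent under the parent's own colour. Root slots are empty, so the creation point
  exists.\<close>

lemma a_anc:
  assumes "v \<in> V" "c \<le> k" "a v c \<noteq> 0"
  shows "\<exists>u\<in>V. \<kappa> u = a v c \<and> col u = c \<and> below u v \<and> d u < d v"
proof -
  have "a v c \<noteq> 0 \<longrightarrow> (\<exists>u\<in>V. \<kappa> u = a v c \<and> col u = c \<and> below u v \<and> d u < d v)"
    using assms(1)
  proof (rule top_down)
    show "a r c \<noteq> 0 \<longrightarrow> (\<exists>u\<in>V. \<kappa> u = a r c \<and> col u = c \<and> below u r \<and> d u < d r)"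
      using a_root assms(2) by simp
  next
    fix v assume v: "v \<in> V" "v \<noteq> r"
      and IH: "a (p v) c \<noteq> 0 \<longrightarrow>
        (\<exists>u\<in>V. \<kappa> u = a (p v) c \<and> col u = c \<and> below u (p v) \<and> d u < d (p v))"
    show "a v c \<noteq> 0 \<longrightarrow> (\<exists>u\<in>V. \<kappa> u = a v c \<and> col u = c \<and> below u v \<and> d u < d v)"
    proof
      assume nz: "a v c \<noteq> 0"
      from a_step[OF v assms(2) nz]
      show "\<exists>u\<in>V. \<kappa> u = a v c \<and> col u = c \<and> below u v \<and> d u < d v"
      proof
        assume "a v c = \<kappa> (p v) \<and> c = col (p v)"
        then show ?thesis using v par_in depth_par by (intro bexI[of _ "p v"]) (auto intro: anc.intros)
      next
        assume "a v c = a (p v) c"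
        then obtain u where "u \<in> V" "\<kappa> u = a v c" "col u = c" "below u (p v)" "d u < d (p v)"
          using IH nz by auto
        then show ?thesis using v depth_par by (intro bexI[of _ u]) (auto intro: anc.intros)
      qed
    qed
  qed
  with assms(3) show ?thesis by simp
qed

lemma a_anc_key:
  assumes "v \<in> V" "c \<le> k" "a v c = \<kappa> u" "u \<in> V"
  shows "col u = c \<and> below u v \<and> d u < d v"
proof -
  have "a v c \<noteq> 0" using assms key_nz by simp
  then obtain u' where "u' \<in> V" "\<kappa> u' = a v c" "col u' = c" "below u' v" "d u' < d v"
    using a_anc assms by blast
  then show ?thesis using assms key_eq[of u u'] by metis
qed

text \<open>Were the edge named at the upper end \<open>u\<close>, then \<open>a_anc_key\<close>
  would make \<open>v\<close> an ancestor of \<open>u\<close>, against the depths.\<close>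

lemma edge_up:
  assumes "E u v" "d u < d v"
  shows "a v (col u) = \<kappa> u \<and> below u v"
  using edge_a[OF assms(1)]
proof (elim disjE exE conjE)
  fix c assume "c \<le> k" "a u c = \<kappa> v"
  with a_anc_key[of u c v] edge_in[OF assms(1)] assms(2) show ?thesis by auto
qed (use a_anc_key edge_in[OF assms(1)] in metis)

lemma edge_depth: "E u v \<Longrightarrow> d u < d v \<or> d v < d u"
  using edge_a a_anc_key edge_in by metis

text \<open>Going up from \<open>w\<close> to \<open>v\<close>, a slot naming \<open>u\<close> can
  only be lost at a vertex whose parent is \<open>u\<close>; every parent met on the way is at least
  as deep as \<open>v\<close>, hence deeper than \<open>u\<close>.\<close>

lemma a_lift:
  assumes "below v w" "w \<in> V" "a w c = \<kappa> u" "u \<in> V" "c \<le> k" "d u < d v"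
  shows "a v c = \<kappa> u"
  using assms
proof (induction rule: anc.induct)
  case (anc_step w v)
  have pw: "p w \<in> V" using anc_step par_in by auto
  have "d v \<le> d (p w)" using anc_depth[OF anc_step(2) pw] by auto
  then have "u \<noteq> p w" using anc_step by auto
  then have "a w c = a (p w) c" using a_step[of w c] anc_step pw key_eq[of u "p w"] key_nz[of u] by auto
  then show ?case using anc_step pw by auto
qed

lemma elim_tree: "elimination_tree V E r p"
  unfolding elimination_tree_def using rooted_tree edge_depth edge_up edge_in by metis

text \<open>A neighbour of \<open>u\<close> in the subtree of \<open>v\<close> names
  \<open>u\<close> in a slot, and \<open>a_lift\<close> carries it up to \<open>v\<close>. The slot
  of \<open>col v\<close> is empty, leaving \<open>k\<close> slots for the strict ancestors in
  str(v).\<close>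

lemma width: "width_le V E r p (int k)"
  unfolding width_le_def
proof
  fix v assume v: "v \<in> V"
  have "strv V E r p v \<subseteq> insert v {u \<in> V. \<kappa> u \<in> a v ` ({..k} - {col v})}"
  proof
    fix u assume "u \<in> strv V E r p v"
    moreover {
      assume u: "u \<in> V" "below u v" "u \<noteq> v" "\<exists>w\<in>subtree V r p v. E u w"
      then obtain w where w: "w \<in> V" "below v w" "E u w" by (auto simp: subtree_def)
      have "d u < d v" using anc_depth[OF u(2) v] u(3) by auto
      moreover have "d v \<le> d w" using anc_depth[OF w(2,1)] by auto
      ultimately have *: "a v (col u) = \<kappa> u"
        using a_lift[OF w(2,1)] edge_up[OF w(3)] u(1) col_le by auto
      then have "col u \<noteq> col v" using a_col[OF v] key_nz[OF u(1)] by auto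
      then have "\<kappa> u \<in> a v ` ({..k} - {col v})"
        using * u(1) col_le by (intro image_eqI[of _ _ "col u"]) auto
    }
    ultimately show "u \<in> insert v {u \<in> V. \<kappa> u \<in> a v ` ({..k} - {col v})}"
      by (auto simp: strv_def)
  qed
  moreover have "card {u \<in> V. \<kappa> u \<in> a v ` ({..k} - {col v})} \<le> card (a v ` ({..k} - {col v}))"
    by (rule card_inj_on_le[of \<kappa>]) (auto intro: inj_on_subset[OF key_inj])
  moreover have "card (a v ` ({..k} - {col v})) \<le> k"
    using card_image_le[of "{..k} - {col v}" "a v"] col_le[OF v] by simp
  ultimately have "card (strv V E r p v) \<le> Suc k"
    using fin card_mono[of "insert v {u \<in> V. \<kappa> u \<in> a v ` ({..k} - {col v})}" "strv V E r p v"]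
      card_insert_le_m1[of "Suc k" "{u \<in> V. \<kappa> u \<in> a v ` ({..k} - {col v})}" v]
    by auto
  then show "int (card (strv V E r p v)) - 1 \<le> int k" by linarith
qed

lemma run_exists:
  assumes ext: "\<And>c S m X g g'. (\<forall>x\<in>X. g x = g' x) \<Longrightarrow> f c S m X g = f c S m X g'"
  shows "\<exists>\<rho>. run f M \<rho>"
proof -
  define inv where "inv = inv_into V \<kappa>"
  have inv: "inv (\<kappa> v) = v" if "v \<in> V" for v
    using that key_inj by (simp add: inv_def)
  define F where "F g x = f (col (inv x)) (up_cols (inv x)) (M (inv x)) (\<kappa> ` children (inv x)) g" for g x
  define D where "D = Max (d ` V)"
  \<comment> \<open>One round more than at a child: unfolding a single \<open>F\<close> leaves
    exactly the iterate that defines the children's states.\<close>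
  define \<rho> where "\<rho> x = (F ^^ Suc (D - d (inv x))) (\<lambda>_. 0) x" for x
  have "\<rho> (\<kappa> v) = f (col v) (up_cols v) (M v) (\<kappa> ` children v) \<rho>" if v: "v \<in> V" for v
  proof -
    have "\<rho> (\<kappa> v) = f (col v) (up_cols v) (M v) (\<kappa> ` children v) ((F ^^ (D - d v)) (\<lambda>_. 0))"
      using v by (simp add: \<rho>_def F_def inv)
    also have "\<dots> = f (col v) (up_cols v) (M v) (\<kappa> ` children v) \<rho>"
    proof (rule ext, safe)
      fix x assume x: "x \<in> children v"
      then have "x \<in> V" "d x = Suc (d v)" using depth_par by (auto simp: children_def)
      moreover have "d x \<le> D" using \<open>x \<in> V\<close> fin by (simp add: D_def)
      ultimately show "(F ^^ (D - d v)) (\<lambda>_. 0) (\<kappa> x) = \<rho> (\<kappa> x)"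
        by (simp add: \<rho>_def inv Suc_diff_Suc del: funpow.simps)
    qed
    finally show ?thesis .
  qed
  then show ?thesis unfolding run_def by blast
qed

end

section \<open>Properties decided by finite-state runs, and their Boolean closure\<close>

text \<open>\<open>N\<close>, \<open>f\<close> and \<open>acc\<close> are fixed before the graph, so
  one finite state set serves all graphs. \<open>P\<close> may use the depth, which orients edges,
  but not the colouring, the slots or the keys.\<close>

definition recognizable ::
    "nat \<Rightarrow> ('v set \<Rightarrow> ('v \<Rightarrow> 'v \<Rightarrow> bool) \<Rightarrow> ('v \<Rightarrow> nat) \<Rightarrow> ('v \<Rightarrow> nat set) \<Rightarrow> bool) \<Rightarrow> bool" where
  "recognizable k P \<longleftrightarrow> (\<exists>N f acc.
     (\<forall>c S m X g. f c S m X g < N) \<and>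
     (\<forall>c S m X g g'. (\<forall>x\<in>X. g x = g' x) \<longrightarrow> f c S m X g = f c S m X g') \<and>
     (\<forall>V E \<kappa> r p d col a M \<rho>. etree k V E \<kappa> r p d col a \<and> etree.run k V E \<kappa> r p col a f M \<rho> \<longrightarrow>
        (acc (\<rho> (\<kappa> r)) \<longleftrightarrow> P V E d M)))"

lemma recognizableI:
  assumes "\<And>c S m X g. f c S m X g < N"
    and "\<And>c S m X g g'. (\<And>x. x \<in> X \<Longrightarrow> g x = g' x) \<Longrightarrow> f c S m X g = f c S m X g'"
    and "\<And>V E \<kappa> r p d col a M \<rho>. etree k V E \<kappa> r p d col a \<Longrightarrow>
        etree.run k V E \<kappa> r p col a f M \<rho> \<Longrightarrow> acc (\<rho> (\<kappa> r)) \<longleftrightarrow> P V E d M"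
  shows "recognizable k P"
  unfolding recognizable_def
  by (intro exI[of _ N] exI[of _ f] exI[of _ acc] conjI allI impI, rule assms(1), rule assms(2), blast,
      rule assms(3), blast+)

lemma recognizableE:
  assumes "recognizable k P"
  obtains N f acc where "\<And>c S m X g. f c S m X g < N"
    and "\<And>c S m X g g'. (\<And>x. x \<in> X \<Longrightarrow> g x = g' x) \<Longrightarrow> f c S m X g = f c S m X g'"
    and "\<And>V E \<kappa> r p d col a M \<rho>. etree k V E \<kappa> r p d col a \<Longrightarrow>
        etree.run k V E \<kappa> r p col a f M \<rho> \<Longrightarrow> acc (\<rho> (\<kappa> r)) \<longleftrightarrow> P V E d M"
  using assms unfolding recognizable_def
proof (elim exE conjE)
  fix N f acc
  assume "\<forall>c S m X g. f c S m X g < N"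
    "\<forall>c S m X g g'. (\<forall>x\<in>X. g x = g' x) \<longrightarrow> f c S m X g = f c S m X g'"
    "\<forall>V E \<kappa> r p d col a M \<rho>. etree k V E \<kappa> r p d col a \<and> etree.run k V E \<kappa> r p col a f M \<rho> \<longrightarrow>
        (acc (\<rho> (\<kappa> r)) \<longleftrightarrow> P V E d M)"
  then show thesis by (intro that[of f N acc]) simp_all
qed

lemma recognizable_Not:
  assumes "recognizable k P"
  shows "recognizable k (\<lambda>V E d M. \<not> P V E d M)"
proof -
  from assms obtain N f acc where *: "\<And>c S m X g. f c S m X g < N"
    "\<And>c S m X g g'. (\<And>x. x \<in> X \<Longrightarrow> g x = g' x) \<Longrightarrow> f c S m X g = f c S m X g'"
    "\<And>V E \<kappa> r p d col a M \<rho>. etree k V E \<kappa> r p d col a \<Longrightarrow>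
        etree.run k V E \<kappa> r p col a f M \<rho> \<Longrightarrow> acc (\<rho> (\<kappa> r)) \<longleftrightarrow> P V E d M"
    by (rule recognizableE) blast
  show ?thesis
  proof (rule recognizableI[of f N _ "\<lambda>s. \<not> acc s"])
    fix V :: "'a set" and E \<kappa> r p d col a M \<rho>
    assume "etree k V E \<kappa> r p d col a" "etree.run k V E \<kappa> r p col a f M \<rho>"
    then show "\<not> acc (\<rho> (\<kappa> r)) \<longleftrightarrow> \<not> P V E d M" using *(3) by simp
  qed (rule *(1), rule *(2), blast)
qed

text \<open>Product construction: a pair of states \<open>s\<close>, \<open>t\<close> is coded as
  \<open>s + N * t\<close> and recovered by \<open>mod\<close> and \<open>div\<close>.\<close>

lemma recognizable_And:
  assumes "recognizable k P" "recognizable k P'"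
  shows "recognizable k (\<lambda>V E d M. P V E d M \<and> P' V E d M)"
proof -
  from assms(1) obtain N f acc where 1: "\<And>c S m X g. f c S m X g < N"
    "\<And>c S m X g g'. (\<And>x. x \<in> X \<Longrightarrow> g x = g' x) \<Longrightarrow> f c S m X g = f c S m X g'"
    "\<And>V E \<kappa> r p d col a M \<rho>. etree k V E \<kappa> r p d col a \<Longrightarrow>
        etree.run k V E \<kappa> r p col a f M \<rho> \<Longrightarrow> acc (\<rho> (\<kappa> r)) \<longleftrightarrow> P V E d M"
    by (rule recognizableE) blast
  from assms(2) obtain N' f' acc' where 2: "\<And>c S m X g. f' c S m X g < N'"
    "\<And>c S m X g g'. (\<And>x. x \<in> X \<Longrightarrow> g x = g' x) \<Longrightarrow> f' c S m X g = f' c S m X g'"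
    "\<And>V E \<kappa> r p d col a M \<rho>. etree k V E \<kappa> r p d col a \<Longrightarrow>
        etree.run k V E \<kappa> r p col a f' M \<rho> \<Longrightarrow> acc' (\<rho> (\<kappa> r)) \<longleftrightarrow> P' V E d M"
    by (rule recognizableE) blast
  define h where "h c S m X g = f c S m X (\<lambda>x. g x mod N) + N * f' c S m X (\<lambda>x. g x div N)" for c S m X g
  have hmod: "h c S m X g mod N = f c S m X (\<lambda>x. g x mod N)" for c S m X g
    using 1(1) by (simp add: h_def)
  have hdiv: "h c S m X g div N = f' c S m X (\<lambda>x. g x div N)" for c S m X g
    using 1(1)[of c S m X "\<lambda>x. g x mod N"] by (simp add: h_def)
  show ?thesis
  proof (rule recognizableI[of h "N * N'" _ "\<lambda>s. acc (s mod N) \<and> acc' (s div N)"])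
    fix c S m X g
    have "h c S m X g < N + N * f' c S m X (\<lambda>x. g x div N)" using 1(1) by (simp add: h_def)
    also have "\<dots> = N * Suc (f' c S m X (\<lambda>x. g x div N))" by simp
    also have "\<dots> \<le> N * N'" using 2(1) by (intro mult_le_mono2 Suc_leI)
    finally show "h c S m X g < N * N'" .
  next
    fix c S m X g g' assume "\<And>x :: nat. x \<in> X \<Longrightarrow> g x = (g' x :: nat)"
    then show "h c S m X g = h c S m X g'" unfolding h_def
      by (intro arg_cong2[of _ _ _ _ "(+)"] arg_cong2[of _ _ _ _ "(*)"] 1(2) 2(2)) auto
  next
    fix V :: "'a set" and E \<kappa> r p d col a M \<rho>
    assume e: "etree k V E \<kappa> r p d col a" and r: "etree.run k V E \<kappa> r p col a h M \<rho>"
    have "etree.run k V E \<kappa> r p col a f M (\<lambda>x. \<rho> x mod N)"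
      using r unfolding etree.run_def[OF e] using hmod by metis
    moreover have "etree.run k V E \<kappa> r p col a f' M (\<lambda>x. \<rho> x div N)"
      using r unfolding etree.run_def[OF e] using hdiv by metis
    ultimately show "acc (\<rho> (\<kappa> r) mod N) \<and> acc' (\<rho> (\<kappa> r) div N) \<longleftrightarrow> P V E d M \<and> P' V E d M"
      using 1(3)[OF e] 2(3)[OF e] by blast
  qed
qed

lemma recognizable_Or:
  assumes "recognizable k P" "recognizable k P'"
  shows "recognizable k (\<lambda>V E d M. P V E d M \<or> P' V E d M)"
  using recognizable_Not[OF recognizable_And[OF recognizable_Not[OF assms(1)] recognizable_Not[OF assms(2)]]]
  by simp

section \<open>Existential choice of marks\<close>

lemma set_encode_less:
  assumes "A \<subseteq> {..<N}"
  shows "set_encode A < 2 ^ N"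
proof -
  have "(\<Sum>i\<in>A. 2 ^ i) \<le> (\<Sum>i\<in>{..<N}. 2 ^ i :: nat)"
    by (rule sum_mono2[OF _ assms]) simp_all
  also have "\<dots> = 2 ^ N - 1"
    by (induction N) simp_all
  also have "\<dots> < 2 ^ N" by simp
  finally show ?thesis by (simp add: set_encode_def)
qed

text \<open>Mark \<open>i\<close> is overwritten on both sides of \<open>A\<close>, as a quantifier
  overrides an outer binding of its variable.\<close>

definition set_mark :: "nat \<Rightarrow> 'v set \<Rightarrow> ('v \<Rightarrow> nat set) \<Rightarrow> 'v \<Rightarrow> nat set" where
  "set_mark i A M v = (if v \<in> A then insert i (M v) else M v - {i})"

text \<open>The powerset construction; an accepting computation for some choice of marks is reassembled
  from the root downwards.\<close>

lemma recognizable_Ex: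
  assumes "recognizable k P"
  shows "recognizable k (\<lambda>V E d M. \<exists>A. P V E d (set_mark i A M))"
proof -
  from assms obtain N f acc where f: "\<And>c S m X g. f c S m X g < N"
    "\<And>c S m X g g'. (\<And>x. x \<in> X \<Longrightarrow> g x = g' x) \<Longrightarrow> f c S m X g = f c S m X g'"
    "\<And>V E \<kappa> r p d col a M \<rho>. etree k V E \<kappa> r p d col a \<Longrightarrow>
        etree.run k V E \<kappa> r p col a f M \<rho> \<Longrightarrow> acc (\<rho> (\<kappa> r)) \<longleftrightarrow> P V E d M"
    by (rule recognizableE) blast
  \<comment> \<open>A state codes a set of \<open>f\<close>-states: those obtained from either value
    of mark \<open>i\<close> at this vertex and any selection \<open>g\<close> of one member from
    each child's set.\<close>
  define H where "H c S m X G =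
    {f c S (if b then insert i m else m - {i}) X g | b g. \<forall>x\<in>X. g x \<in> set_decode (G x)}"
    for c S m X and G :: "nat \<Rightarrow> nat"
  have Hsub: "H c S m X G \<subseteq> {..<N}" for c S m X G using f(1) by (auto simp: H_def)
  define h where "h c S m X G = set_encode (H c S m X G)" for c S m X G
  have hdec: "set_decode (h c S m X G) = H c S m X G" for c S m X G
    using finite_subset[OF Hsub] by (simp add: h_def)
  show ?thesis
  proof (rule recognizableI[of h "2 ^ N" _ "\<lambda>s. \<exists>t\<in>set_decode s. acc t"])
    show "h c S m X g < 2 ^ N" for c S m X g
      unfolding h_def by (rule set_encode_less[OF Hsub])
  next
    fix c S m X g g' assume "\<And>x :: nat. x \<in> X \<Longrightarrow> g x = (g' x :: nat)"
    then show "h c S m X g = h c S m X g'" unfolding h_def H_def by auto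
  next
    fix V :: "'a set" and E \<kappa> r p d col a M \<rho>
    assume e: "etree k V E \<kappa> r p d col a" and run: "etree.run k V E \<kappa> r p col a h M \<rho>"
    interpret etree k V E \<kappa> r p d col a by fact
    have dec: "set_decode (\<rho> (\<kappa> v)) = H (col v) (up_cols v) (M v) (\<kappa> ` children v) \<rho>" if "v \<in> V" for v
      using run that unfolding run_def hdec[symmetric] by simp
    show "(\<exists>t\<in>set_decode (\<rho> (\<kappa> r)). acc t) \<longleftrightarrow> (\<exists>A. P V E d (set_mark i A M))"
    proof
      assume "\<exists>A. P V E d (set_mark i A M)"
      then obtain A where A: "P V E d (set_mark i A M)" by blast
      obtain \<sigma> where \<sigma>: "run f (set_mark i A M) \<sigma>" using run_exists f(2) by metis
      have "\<sigma> (\<kappa> v) \<in> set_decode (\<rho> (\<kappa> v))" if "v \<in> V" for v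
        using that
      proof (rule bottom_up)
        fix v assume v: "v \<in> V" and IH: "\<And>x. x \<in> children v \<Longrightarrow> \<sigma> (\<kappa> x) \<in> set_decode (\<rho> (\<kappa> x))"
        have "\<sigma> (\<kappa> v) = f (col v) (up_cols v) (set_mark i A M v) (\<kappa> ` children v) \<sigma>"
          using \<sigma> v by (simp add: run_def)
        then show "\<sigma> (\<kappa> v) \<in> set_decode (\<rho> (\<kappa> v))"
          unfolding dec[OF v] H_def set_mark_def using IH
          by (intro CollectI exI[of _ "v \<in> A"] exI[of _ \<sigma>]) auto
      qed
      then show "\<exists>t\<in>set_decode (\<rho> (\<kappa> r)). acc t"
        using f(3)[OF e \<sigma>] A root_in by blast
    next
      assume "\<exists>t\<in>set_decode (\<rho> (\<kappa> r)). acc t"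
      then obtain t where t: "t \<in> set_decode (\<rho> (\<kappa> r))" "acc t" by blast
      \<comment> \<open>Every member of a state set has a local origin, namely a mark bit and child
        states; choice turns these into functions of the vertex and its state.\<close>
      have "\<exists>b g. v \<in> V \<longrightarrow> s \<in> set_decode (\<rho> (\<kappa> v)) \<longrightarrow>
          s = f (col v) (up_cols v) (if b then insert i (M v) else M v - {i}) (\<kappa> ` children v) g \<and>
          (\<forall>x\<in>children v. g (\<kappa> x) \<in> set_decode (\<rho> (\<kappa> x)))" for v s
      proof (cases "v \<in> V \<and> s \<in> set_decode (\<rho> (\<kappa> v))")
        case True
        then have "s \<in> H (col v) (up_cols v) (M v) (\<kappa> ` children v) \<rho>" using dec[of v] by blast
        then show ?thesis unfolding H_def by fast
      qed auto
      then obtain b g where bg: "\<And>v s. v \<in> V \<Longrightarrow> s \<in> set_decode (\<rho> (\<kappa> v)) \<Longrightarrow>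
          s = f (col v) (up_cols v) (if b v s then insert i (M v) else M v - {i}) (\<kappa> ` children v) (g v s) \<and>
          (\<forall>x\<in>children v. g v s (\<kappa> x) \<in> set_decode (\<rho> (\<kappa> x)))" by metis
      \<comment> \<open>Recursion on the depth: the state of \<open>v\<close> is the one that the
        choice at \<open>p v\<close>, made for the state of \<open>p v\<close>, assigns to
        \<open>v\<close>. The accepting state \<open>t\<close> starts it at the root.\<close>
      define T where "T n = rec_nat (\<lambda>_. t) (\<lambda>_ T' v. g (p v) (T' (p v)) (\<kappa> v)) n" for n
      define \<tau> where "\<tau> v = T (d v) v" for v
      have \<tau>r: "\<tau> r = t" by (simp add: \<tau>_def T_def depth_root)
      have \<tau>s: "\<tau> v = g (p v) (\<tau> (p v)) (\<kappa> v)" if "v \<in> V" "v \<noteq> r" for v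
        using depth_par[OF that] by (simp add: \<tau>_def T_def)
      have mem: "\<tau> v \<in> set_decode (\<rho> (\<kappa> v))" if "v \<in> V" for v
        using that
      proof (rule top_down)
        show "\<tau> r \<in> set_decode (\<rho> (\<kappa> r))" using t \<tau>r by simp
      next
        fix v assume "v \<in> V" "v \<noteq> r" "\<tau> (p v) \<in> set_decode (\<rho> (\<kappa> (p v)))"
        then show "\<tau> v \<in> set_decode (\<rho> (\<kappa> v))"
          using bg[of "p v" "\<tau> (p v)"] par_in[of v] \<tau>s by (auto simp: children_def)
      qed
      define A where "A = {v. b v (\<tau> v)}"
      define \<sigma> where "\<sigma> x = \<tau> (inv_into V \<kappa> x)" for x
      have \<sigma>: "\<sigma> (\<kappa> v) = \<tau> v" if "v \<in> V" for v using that key_inj by (simp add: \<sigma>_def)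
      have "run f (set_mark i A M) \<sigma>" unfolding run_def
      proof
        fix v assume v: "v \<in> V"
        have "\<sigma> (\<kappa> v) = f (col v) (up_cols v) (set_mark i A M v) (\<kappa> ` children v) (g v (\<tau> v))"
          unfolding \<sigma>[OF v] using bg[OF v mem[OF v]] by (simp add: A_def set_mark_def)
        also have "\<dots> = f (col v) (up_cols v) (set_mark i A M v) (\<kappa> ` children v) \<sigma>"
          by (rule f(2)) (auto simp: children_def \<sigma> \<tau>s)
        finally show "\<sigma> (\<kappa> v) = \<dots>" .
      qed
      from f(3)[OF e this] show "\<exists>A. P V E d (set_mark i A M)" using t \<tau>r \<sigma> root_in by auto
    qed
  qed
qed

section \<open>Atomic properties of marks\<close>

lemma recognizable_exists_vertex: "recognizable k (\<lambda>V E d M. \<exists>v\<in>V. Q (M v))"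
proof -
  define h where "h c S m X g = (if Q m \<or> (\<exists>x\<in>X. g x = 1) then 1 else 0 :: nat)"
    for c :: nat and S :: "nat set" and m and X :: "nat set" and g :: "nat \<Rightarrow> nat"
  show ?thesis
  proof (rule recognizableI[of h 2 _ "\<lambda>s. s = 1"])
    fix V :: "'a set" and E \<kappa> r p d col a M \<rho>
    assume e: "etree k V E \<kappa> r p d col a" and run: "etree.run k V E \<kappa> r p col a h M \<rho>"
    interpret etree k V E \<kappa> r p d col a by fact
    have "\<rho> (\<kappa> v) = 1 \<longleftrightarrow> (\<exists>w\<in>V. below v w \<and> Q (M w))" if "v \<in> V" for v
      using that
    proof (rule bottom_up)
      fix v assume v: "v \<in> V"
        and IH: "\<And>x. x \<in> children v \<Longrightarrow> \<rho> (\<kappa> x) = 1 \<longleftrightarrow> (\<exists>w\<in>V. below x w \<and> Q (M w))"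
      have "\<rho> (\<kappa> v) = 1 \<longleftrightarrow> Q (M v) \<or> (\<exists>x\<in>children v. \<rho> (\<kappa> x) = 1)"
        using run v unfolding run_def h_def by auto
      also have "\<dots> \<longleftrightarrow> (\<exists>w\<in>V. below v w \<and> Q (M w))"
        using IH v anc_iff_top[OF v] by blast
      finally show "\<rho> (\<kappa> v) = 1 \<longleftrightarrow> \<dots>" .
    qed
    from this[OF root_in] show "\<rho> (\<kappa> r) = 1 \<longleftrightarrow> (\<exists>v\<in>V. Q (M v))" using root_anc by auto
  qed (auto simp: h_def)
qed

text \<open>The state at \<open>v\<close> is the set of colours of those ancestors of \<open>v\<close> that are adjacent to an
  \<open>i\<close>-marked descendant of \<open>v\<close>, together with \<open>k + 1\<close> once a suitable edge has been found.\<close>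

lemma recognizable_edge_up:
  "recognizable k (\<lambda>V E d M. \<exists>u w. E w u \<and> d u < d w \<and> i \<in> M w \<and> j \<in> M u)"
proof -
  define U where "U X g = (\<Union>x\<in>X. set_decode (g x))" for X :: "nat set" and g :: "nat \<Rightarrow> nat"
  \<comment> \<open>A pending colour \<open>c\<close> arriving at a vertex of colour
    \<open>c\<close> means that vertex: it is consumed, and yields the flag \<open>Suc k\<close> if
    mark \<open>j\<close> is present. Colours are at most \<open>k\<close>, so removing
    \<open>c\<close> never removes the flag.\<close>
  define H where "H c S m X g = (if i \<in> m then S \<inter> {..k} else {}) \<union> (U X g \<inter> {..Suc k} - {c}) \<union>
     (if c \<in> U X g \<and> j \<in> m then {Suc k} else {})"
    for c :: nat and S :: "nat set" and m and X :: "nat set" and g :: "nat \<Rightarrow> nat"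
  have Hsub: "H c S m X g \<subseteq> {..<Suc (Suc k)}" for c S m X g by (auto simp: H_def)
  define h where "h c S m X g = set_encode (H c S m X g)" for c S m X g
  have hdec: "set_decode (h c S m X g) = H c S m X g" for c S m X g
    using finite_subset[OF Hsub] by (simp add: h_def)
  show ?thesis
  proof (rule recognizableI[of h "2 ^ Suc (Suc k)" _ "\<lambda>s. Suc k \<in> set_decode s"])
    show "h c S m X g < 2 ^ Suc (Suc k)" for c S m X g
      unfolding h_def by (rule set_encode_less[OF Hsub])
  next
    fix c S m X g g' assume "\<And>x :: nat. x \<in> X \<Longrightarrow> g x = (g' x :: nat)"
    then have "U X g = U X g'" by (simp add: U_def)
    then show "h c S m X g = h c S m X g'" unfolding h_def H_def by simp
  next
    fix V :: "'a set" and E \<kappa> r p d col a M \<rho>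
    assume e: "etree k V E \<kappa> r p d col a" and run: "etree.run k V E \<kappa> r p col a h M \<rho>"
    interpret etree k V E \<kappa> r p d col a by fact
    define T where "T v = set_decode (\<rho> (\<kappa> v))" for v
    have T: "T v = H (col v) (up_cols v) (M v) (\<kappa> ` children v) \<rho>" if "v \<in> V" for v
      using run that unfolding run_def hdec[symmetric] T_def by simp
    have UT: "U (\<kappa> ` children v) \<rho> = (\<Union>x\<in>children v. T x)" for v by (simp add: U_def T_def)
    have ch: "x \<in> V \<and> x \<noteq> r \<and> p x = v \<and> d x = Suc (d v)" if "x \<in> children v" for x v
      using that depth_par by (auto simp: children_def)
    \<comment> \<open>Colour \<open>c\<close> in the state at \<open>v\<close> means the vertex in
      slot \<open>c\<close> of \<open>v\<close>; a filled slot of a child agrees with that of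
      \<open>v\<close> unless it names \<open>v\<close> itself.\<close>
    have pend: "c \<in> T v \<longleftrightarrow> (\<exists>w\<in>V. below v w \<and> i \<in> M w \<and> (\<exists>u\<in>V. \<kappa> u = a v c \<and> E w u))"
      if "v \<in> V" and c: "c \<le> k" for v c
      using that(1)
    proof (rule bottom_up)
      fix v assume v: "v \<in> V"
        and IH: "\<And>x. x \<in> children v \<Longrightarrow>
           c \<in> T x \<longleftrightarrow> (\<exists>w\<in>V. below x w \<and> i \<in> M w \<and> (\<exists>u\<in>V. \<kappa> u = a x c \<and> E w u))"
      have "c \<in> T v \<longleftrightarrow> i \<in> M v \<and> c \<in> up_cols v \<or> (\<exists>x\<in>children v. c \<in> T x \<and> c \<noteq> col v)"
        using T[OF v] c unfolding H_def UT by (auto split: if_splits)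
      also have "\<dots> \<longleftrightarrow> (\<exists>w\<in>V. below v w \<and> i \<in> M w \<and> (\<exists>u\<in>V. \<kappa> u = a v c \<and> E w u))" (is "?L \<longleftrightarrow> ?R")
      proof
        assume ?L
        then show ?R
        proof
          assume "i \<in> M v \<and> c \<in> up_cols v"
          then obtain w where "i \<in> M v" "E v w" "\<kappa> w = a v c" by (auto simp: up_cols_def)
          then show ?R using v edge_in[of v w] anc.anc_refl[of V r p v] by blast
        next
          assume "\<exists>x\<in>children v. c \<in> T x \<and> c \<noteq> col v"
          then obtain x where x: "x \<in> children v" "c \<in> T x" "c \<noteq> col v" by blast
          then obtain w u where w: "w \<in> V" "below x w" "i \<in> M w" "u \<in> V" "\<kappa> u = a x c" "E w u"
            using IH by blast
          have "a x c = a v c" using a_step[of x c] ch[OF x(1)] w key_nz[of u] x(3) c by auto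
          moreover have "below v w" using w anc_trans anc_child[OF x(1)] by blast
          ultimately show ?R using w by auto
        qed
      next
        assume ?R
        then obtain w u where w: "w \<in> V" "below v w" "i \<in> M w" "u \<in> V" "\<kappa> u = a v c" "E w u" by blast
        from anc_cases_top[OF w(2,1)] show ?L
        proof
          assume "w = v" then show ?L using w c by (auto simp: up_cols_def)
        next
          assume "\<exists>x\<in>children v. below x w"
          then obtain x where x: "x \<in> children v" "below x w" by blast
          have cv: "c \<noteq> col v" using a_col[OF v] w key_nz[of u] by auto
          have u: "col u = c" "d u < d v" using a_anc_key[OF v c _ w(4)] w by auto
          have "d v \<le> d w" using anc_depth[OF w(2,1)] by auto
          then have "a w c = \<kappa> u" using edge_up[of u w] edge_in w u by auto
          then have "a x c = \<kappa> u" using a_lift[OF x(2) w(1) _ w(4) c] u ch[OF x(1)] by auto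
          then show ?L using IH[OF x(1)] x w cv by auto
        qed
      qed
      finally show "c \<in> T v \<longleftrightarrow> \<dots>" .
    qed
    \<comment> \<open>The edge counted here lies entirely below \<open>v\<close>; it is found when
      the run reaches its upper end, which \<open>anc_cases_top\<close> places at \<open>v\<close>
      or below a child.\<close>
    have found: "Suc k \<in> T v \<longleftrightarrow>
        (\<exists>u w. E w u \<and> below v u \<and> below v w \<and> d u < d w \<and> i \<in> M w \<and> j \<in> M u)" if "v \<in> V" for v
      using that
    proof (rule bottom_up)
      fix v assume v: "v \<in> V"
        and IH: "\<And>x. x \<in> children v \<Longrightarrow> Suc k \<in> T x \<longleftrightarrow>
           (\<exists>u w. E w u \<and> below x u \<and> below x w \<and> d u < d w \<and> i \<in> M w \<and> j \<in> M u)"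
      have "Suc k \<in> T v \<longleftrightarrow> (\<exists>x\<in>children v. Suc k \<in> T x) \<or> (\<exists>x\<in>children v. col v \<in> T x) \<and> j \<in> M v"
        using T[OF v] col_le[OF v] unfolding H_def UT by (auto split: if_splits)
      also have "\<dots> \<longleftrightarrow> (\<exists>u w. E w u \<and> below v u \<and> below v w \<and> d u < d w \<and> i \<in> M w \<and> j \<in> M u)" (is "?L \<longleftrightarrow> ?R")
      proof
        assume ?L
        then show ?R
        proof
          assume "\<exists>x\<in>children v. Suc k \<in> T x"
          then show ?R using IH anc_trans anc_child by metis
        next
          assume "(\<exists>x\<in>children v. col v \<in> T x) \<and> j \<in> M v"
          then obtain x where x: "x \<in> children v" "col v \<in> T x" "j \<in> M v" by blast
          then obtain w u where w: "w \<in> V" "below x w" "i \<in> M w" "u \<in> V" "\<kappa> u = a x (col v)" "E w u"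
            using pend col_le[OF v] ch[OF x(1)] by blast
          have "a x (col v) = \<kappa> v" using a_step[of x "col v"] ch[OF x(1)] w key_nz[of u] col_le[OF v] a_col[OF v] by auto
          then have "u = v" using w v key_eq by auto
          moreover have "d v < d w" using anc_depth[OF w(2,1)] ch[OF x(1)] by auto
          moreover have "below v w" using w anc_trans anc_child[OF x(1)] by blast
          ultimately show ?R using w x anc.anc_refl by metis
        qed
      next
        assume ?R
        then obtain u w where w: "E w u" "below v u" "below v w" "d u < d w" "i \<in> M w" "j \<in> M u" by blast
        have wV: "w \<in> V" "u \<in> V" "E u w" using edge_in w by auto
        note up = edge_up[OF wV(3) w(4)]
        from anc_cases_top[OF w(2) wV(2)] show ?L
        proof
          assume uv: "u = v"
          then obtain x where x: "x \<in> children v" "below x w"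
            using anc_cases_top[OF w(3) wV(1)] w(4) by auto
          have "a x (col v) = \<kappa> v" using a_lift[OF x(2) wV(1)] up uv ch[OF x(1)] v col_le by auto
          then have "col v \<in> T x" using pend[of x "col v"] x w wV uv ch[OF x(1)] col_le[OF v] by auto
          then show ?L using x w uv by auto
        next
          assume "\<exists>x\<in>children v. below x u"
          then obtain x where x: "x \<in> children v" "below x u" by blast
          then have "below x w" using anc_trans up by blast
          then show ?L using IH[OF x(1)] x w by blast
        qed
      qed
      finally show "Suc k \<in> T v \<longleftrightarrow> \<dots>" .
    qed
    show "Suc k \<in> set_decode (\<rho> (\<kappa> r)) \<longleftrightarrow> (\<exists>u w. E w u \<and> d u < d w \<and> i \<in> M w \<and> j \<in> M u)"
      using found[OF root_in] root_anc edge_in unfolding T_def by metis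
  qed
qed

lemma recognizable_cong:
  assumes "recognizable k P"
    and "\<And>V E \<kappa> r p d col a M. etree k V E \<kappa> r p d col a \<Longrightarrow> P V E d M \<longleftrightarrow> P' V E d M"
  shows "recognizable k P'"
proof -
  from assms(1) obtain N f acc where *: "\<And>c S m X g. f c S m X g < N"
    "\<And>c S m X g g'. (\<And>x. x \<in> X \<Longrightarrow> g x = g' x) \<Longrightarrow> f c S m X g = f c S m X g'"
    "\<And>V E \<kappa> r p d col a M \<rho>. etree k V E \<kappa> r p d col a \<Longrightarrow>
        etree.run k V E \<kappa> r p col a f M \<rho> \<Longrightarrow> acc (\<rho> (\<kappa> r)) \<longleftrightarrow> P V E d M"
    by (rule recognizableE) blast
  show ?thesis
  proof (rule recognizableI[of f N _ acc])
    fix V :: "'a set" and E \<kappa> r p d col a M \<rho>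
    assume e: "etree k V E \<kappa> r p d col a" and run: "etree.run k V E \<kappa> r p col a f M \<rho>"
    show "acc (\<rho> (\<kappa> r)) \<longleftrightarrow> P' V E d M" using *(3)[OF e run] assms(2)[OF e] by simp
  qed (rule *(1), rule *(2), blast)
qed

text \<open>The ends of an edge differ in depth, so the two upward versions cover both
  orientations.\<close>

lemma recognizable_edge: "recognizable k (\<lambda>V E d M. \<exists>u w. E u w \<and> i \<in> M u \<and> j \<in> M w)"
proof (rule recognizable_cong[OF recognizable_Or[OF recognizable_edge_up[of k i j] recognizable_edge_up[of k j i]]])
  fix V :: "'a set" and E \<kappa> r p d col a M
  assume "etree k V E \<kappa> r p d col a"
  then interpret etree k V E \<kappa> r p d col a .
  show "(\<exists>u w. E w u \<and> d u < d w \<and> i \<in> M w \<and> j \<in> M u) \<or> (\<exists>u w. E w u \<and> d u < d w \<and> j \<in> M w \<and> i \<in> M u)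
    \<longleftrightarrow> (\<exists>u w. E u w \<and> i \<in> M u \<and> j \<in> M w)" (is "?L \<longleftrightarrow> ?R")
  proof
    assume ?R
    then obtain u w where uw: "E u w" "E w u" "i \<in> M u" "j \<in> M w" using edge_in by blast
    with edge_depth[OF uw(1)] show ?L by blast
  next
    assume ?L
    then show ?R using edge_in by blast
  qed
qed

text \<open>Two distinct \<open>i\<close>-marked vertices exist iff some set contains one
  \<open>i\<close>-marked vertex and misses another; that set is quantified on the auxiliary mark
  \<open>Suc i\<close>.\<close>

lemma recognizable_singleton: "recognizable k (\<lambda>V E d M. \<exists>!v :: 'v. v \<in> V \<and> i \<in> M v)"
proof -
  let ?two = "\<lambda>V E d M. \<exists>A. (\<exists>v\<in>V. i \<in> set_mark (Suc i) A M v \<and> Suc i \<in> set_mark (Suc i) A M v) \<and>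
     (\<exists>v\<in>V. i \<in> set_mark (Suc i) A M v \<and> Suc i \<notin> set_mark (Suc i) A M v)"
  have "?two V E d M \<longleftrightarrow> (\<exists>u\<in>V. \<exists>v\<in>V. u \<noteq> v \<and> i \<in> M u \<and> i \<in> M v)" (is "?L = ?R")
    for V :: "'v set" and E :: "'v \<Rightarrow> 'v \<Rightarrow> bool" and d :: "'v \<Rightarrow> nat" and M
  proof
    assume ?R
    then obtain u v where "u \<in> V" "v \<in> V" "u \<noteq> v" "i \<in> M u" "i \<in> M v" by blast
    then show ?L by (intro exI[of _ "{u}"]) (auto simp: set_mark_def)
  next
    assume ?L
    then obtain A u v where "u \<in> V" "v \<in> V" "u \<in> A" "v \<notin> A" "i \<in> M u" "i \<in> M v"
      by (auto simp: set_mark_def split: if_splits)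
    then show ?R by metis
  qed
  note two = this
  note ex = recognizable_exists_vertex[of k]
  note rec = recognizable_And[OF ex[of "\<lambda>m. i \<in> m"] recognizable_Not[OF recognizable_Ex[OF recognizable_And[OF
    ex[of "\<lambda>m. i \<in> m \<and> Suc i \<in> m"] ex[of "\<lambda>m. i \<in> m \<and> Suc i \<notin> m"]], of "Suc i"]]]
  show ?thesis
  proof (rule recognizable_cong[OF rec])
    fix V :: "'v set" and E \<kappa> r p d col a M
    have "(\<exists>v\<in>V. i \<in> M v) \<and> \<not> (\<exists>u\<in>V. \<exists>v\<in>V. u \<noteq> v \<and> i \<in> M u \<and> i \<in> M v) \<longleftrightarrow>
      (\<exists>!v. v \<in> V \<and> i \<in> M v)" by blast
    then show "(\<exists>v\<in>V. i \<in> M v) \<and> \<not> ?two V E d M \<longleftrightarrow> (\<exists>!v. v \<in> V \<and> i \<in> M v)"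
      unfolding two .
  qed
qed

section \<open>Translation of MSO formulas\<close>

text \<open>Marks \<open>2 x\<close> and \<open>2 X + 1\<close> stand for the vertex variable \<open>x\<close> and the set variable \<open>X\<close>.\<close>

definition marks_ok :: "mso \<Rightarrow> 'v set \<Rightarrow> (nat \<Rightarrow> 'v) \<Rightarrow> (nat \<Rightarrow> 'v set) \<Rightarrow> ('v \<Rightarrow> nat set) \<Rightarrow> bool" where
  "marks_ok \<phi> V I J M \<longleftrightarrow> (\<forall>x\<in>fvV \<phi>. I x \<in> V \<and> (\<forall>v\<in>V. 2 * x \<in> M v \<longleftrightarrow> v = I x)) \<and>
     (\<forall>X\<in>fvS \<phi>. \<forall>v\<in>V. Suc (2 * X) \<in> M v \<longleftrightarrow> v \<in> J X)"

definition recognizes ::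
    "nat \<Rightarrow> mso \<Rightarrow> ('v set \<Rightarrow> ('v \<Rightarrow> 'v \<Rightarrow> bool) \<Rightarrow> ('v \<Rightarrow> nat) \<Rightarrow> ('v \<Rightarrow> nat set) \<Rightarrow> bool) \<Rightarrow> bool" where
  "recognizes k \<phi> P \<longleftrightarrow> recognizable k P \<and> (\<forall>V E \<kappa> r p d col a M I J.
     etree k V E \<kappa> r p d col a \<longrightarrow> marks_ok \<phi> V I J M \<longrightarrow> (P V E d M \<longleftrightarrow> sat V E I J \<phi>))"

lemma recognizesI:
  assumes "recognizable k P"
    and "\<And>V E \<kappa> r p d col a M I J. etree k V E \<kappa> r p d col a \<Longrightarrow> marks_ok \<phi> V I J M \<Longrightarrow>
      P V E d M \<longleftrightarrow> sat V E I J \<phi>"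
  shows "recognizes k \<phi> P"
  using assms unfolding recognizes_def by blast

lemma recognizesD:
  assumes "recognizes k \<phi> P"
  shows "recognizable k P"
    and "etree k V E \<kappa> r p d col a \<Longrightarrow> marks_ok \<phi> V I J M \<Longrightarrow> P V E d M \<longleftrightarrow> sat V E I J \<phi>"
  using assms unfolding recognizes_def by blast+

lemma recognizes_Neg:
  assumes "recognizes k \<phi> P"
  shows "recognizes k (Neg \<phi>) (\<lambda>V E d M. \<not> P V E d M)"
proof (rule recognizesI)
  show "recognizable k (\<lambda>V E d M. \<not> P V E d M)"
    by (rule recognizable_Not[OF recognizesD(1)[OF assms]])
next
  fix V :: "'a set" and E \<kappa> r p d col a M I J
  assume "etree k V E \<kappa> r p d col a" "marks_ok (Neg \<phi>) V I J M"
  then show "\<not> P V E d M \<longleftrightarrow> sat V E I J (Neg \<phi>)"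
    using recognizesD(2)[OF assms] by (simp add: marks_ok_def)
qed

text \<open>A vertex quantifier is a set quantifier restricted to singletons. Rewriting mark
  \<open>2 * x\<close> leaves the marks of all other variables alone, set variables having odd
  marks.\<close>

lemma recognizes_ExV:
  assumes "recognizes k \<phi> P"
  shows "recognizes k (ExV x \<phi>)
    (\<lambda>V E d M. \<exists>A. (\<exists>!v. v \<in> V \<and> 2 * x \<in> set_mark (2 * x) A M v) \<and> P V E d (set_mark (2 * x) A M))"
proof (rule recognizesI)
  show "recognizable k (\<lambda>V E d M. \<exists>A. (\<exists>!v. v \<in> V \<and> 2 * x \<in> set_mark (2 * x) A M v) \<and>
      P V E d (set_mark (2 * x) A M))"
    by (rule recognizable_Ex[where P = "\<lambda>V E d M. (\<exists>!v. v \<in> V \<and> 2 * x \<in> M v) \<and> P V E d M"])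
       (rule recognizable_And[OF recognizable_singleton recognizesD(1)[OF assms]])
next
  fix V :: "'a set" and E \<kappa> r p d col a M I J
  assume e: "etree k V E \<kappa> r p d col a" and m: "marks_ok (ExV x \<phi>) V I J M"
  have ok: "marks_ok \<phi> V (I(x := u)) J (set_mark (2 * x) A M)"
    if "u \<in> V" "\<forall>v\<in>V. 2 * x \<in> set_mark (2 * x) A M v \<longleftrightarrow> v = u" for u A
    using m that unfolding marks_ok_def set_mark_def by (auto split: if_splits) presburger+
  show "(\<exists>A. (\<exists>!v. v \<in> V \<and> 2 * x \<in> set_mark (2 * x) A M v) \<and> P V E d (set_mark (2 * x) A M))
      \<longleftrightarrow> sat V E I J (ExV x \<phi>)"
  proof
    assume "\<exists>A. (\<exists>!v. v \<in> V \<and> 2 * x \<in> set_mark (2 * x) A M v) \<and> P V E d (set_mark (2 * x) A M)"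
    then obtain A u where "u \<in> V" "\<forall>v\<in>V. 2 * x \<in> set_mark (2 * x) A M v \<longleftrightarrow> v = u"
      "P V E d (set_mark (2 * x) A M)" by metis
    then show "sat V E I J (ExV x \<phi>)" using recognizesD(2)[OF assms e ok] by auto
  next
    assume "sat V E I J (ExV x \<phi>)"
    then obtain u where u: "u \<in> V" "sat V E (I(x := u)) J \<phi>" by auto
    have *: "\<forall>v\<in>V. 2 * x \<in> set_mark (2 * x) {u} M v \<longleftrightarrow> v = u" by (auto simp: set_mark_def)
    then have "\<exists>!v. v \<in> V \<and> 2 * x \<in> set_mark (2 * x) {u} M v" using u(1) by (intro ex1I[of _ u]) auto
    moreover have "P V E d (set_mark (2 * x) {u} M)"
      using recognizesD(2)[OF assms e ok[OF u(1) *]] u(2) by simp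
    ultimately show "\<exists>A. (\<exists>!v. v \<in> V \<and> 2 * x \<in> set_mark (2 * x) A M v) \<and> P V E d (set_mark (2 * x) A M)"
      by blast
  qed
qed

lemma recognizes_ExS:
  assumes "recognizes k \<phi> P"
  shows "recognizes k (ExS X \<phi>) (\<lambda>V E d M. \<exists>A. P V E d (set_mark (Suc (2 * X)) A M))"
proof (rule recognizesI)
  show "recognizable k (\<lambda>V E d M. \<exists>A. P V E d (set_mark (Suc (2 * X)) A M))"
    by (rule recognizable_Ex[OF recognizesD(1)[OF assms]])
next
  fix V :: "'a set" and E \<kappa> r p d col a M I J
  assume e: "etree k V E \<kappa> r p d col a" and m: "marks_ok (ExS X \<phi>) V I J M"
  have ok: "marks_ok \<phi> V I (J(X := B)) (set_mark (Suc (2 * X)) A M)"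
    if "\<forall>v\<in>V. v \<in> A \<longleftrightarrow> v \<in> B" for A B
    using m that unfolding marks_ok_def set_mark_def by (auto split: if_splits) presburger+
  \<comment> \<open>\<open>recognizable_Ex\<close> lets \<open>A\<close> leave \<open>V\<close>;
    \<open>A \<inter> V\<close> carries the same marks on \<open>V\<close> and is a legitimate value
    for \<open>X\<close>.\<close>
  have "sat V E I J (ExS X \<phi>)" if "P V E d (set_mark (Suc (2 * X)) A M)" for A
    using recognizesD(2)[OF assms e ok[of A "A \<inter> V"]] that by auto
  moreover have "P V E d (set_mark (Suc (2 * X)) A M)" if "sat V E I (J(X := A)) \<phi>" for A
    using recognizesD(2)[OF assms e ok[of A A]] that by auto
  ultimately show "(\<exists>A. P V E d (set_mark (Suc (2 * X)) A M)) \<longleftrightarrow> sat V E I J (ExS X \<phi>)"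
    by auto
qed

text \<open>Lets disjunction and the universal quantifiers be obtained as De Morgan duals.\<close>

lemma recognizes_transfer:
  fixes P :: "'a set \<Rightarrow> ('a \<Rightarrow> 'a \<Rightarrow> bool) \<Rightarrow> ('a \<Rightarrow> nat) \<Rightarrow> ('a \<Rightarrow> nat set) \<Rightarrow> bool"
  assumes "recognizes k \<phi> P" "fvV \<phi> = fvV \<phi>'" "fvS \<phi> = fvS \<phi>'"
    "\<And>V E I J. sat V E I J \<phi> \<longleftrightarrow> sat (V :: 'a set) E I J \<phi>'"
  shows "recognizes k \<phi>' P"
proof (rule recognizesI[OF recognizesD(1)[OF assms(1)]])
  fix V :: "'a set" and E \<kappa> r p d col a M I J
  assume "etree k V E \<kappa> r p d col a" "marks_ok \<phi>' V I J M"
  then show "P V E d M \<longleftrightarrow> sat V E I J \<phi>'"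
    using recognizesD(2)[OF assms(1), of V E \<kappa> r p d col a I J M] assms(2-4) by (simp add: marks_ok_def)
qed

lemma recognizes_Conj:
  assumes "recognizes k \<phi> P" "recognizes k \<phi>' P'"
  shows "recognizes k (Conj \<phi> \<phi>') (\<lambda>V E d M. P V E d M \<and> P' V E d M)"
proof (rule recognizesI)
  show "recognizable k (\<lambda>V E d M. P V E d M \<and> P' V E d M)"
    by (rule recognizable_And[OF assms[THEN recognizesD(1)]])
next
  fix V :: "'a set" and E \<kappa> r p d col a M I J
  assume "etree k V E \<kappa> r p d col a" "marks_ok (Conj \<phi> \<phi>') V I J M"
  then show "P V E d M \<and> P' V E d M \<longleftrightarrow> sat V E I J (Conj \<phi> \<phi>')"
    using recognizesD(2)[OF assms(1), of V E \<kappa> r p d col a I J M]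
      recognizesD(2)[OF assms(2), of V E \<kappa> r p d col a I J M] by (simp add: marks_ok_def)
qed

lemma mso_recognizable:
  "\<exists>P :: 'v set \<Rightarrow> ('v \<Rightarrow> 'v \<Rightarrow> bool) \<Rightarrow> ('v \<Rightarrow> nat) \<Rightarrow> ('v \<Rightarrow> nat set) \<Rightarrow> bool. recognizes k \<phi> P"
proof (induction \<phi>)
  case (Edge x y)
  have "recognizes k (Edge x y) (\<lambda>V E d M. \<exists>u w. E u w \<and> 2 * x \<in> M u \<and> 2 * y \<in> M (w :: 'v))"
  proof (rule recognizesI[OF recognizable_edge])
    fix V :: "'v set" and E \<kappa> r p d col a M I J
    assume "etree k V E \<kappa> r p d col a" and m: "marks_ok (Edge x y) V I J M"
    then interpret etree k V E \<kappa> r p d col a by simp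
    show "(\<exists>u w. E u w \<and> 2 * x \<in> M u \<and> 2 * y \<in> M w) \<longleftrightarrow> sat V E I J (Edge x y)"
    proof
      assume "\<exists>u w. E u w \<and> 2 * x \<in> M u \<and> 2 * y \<in> M w"
      then obtain u w where uw: "E u w" "2 * x \<in> M u" "2 * y \<in> M w" by blast
      then have "u = I x" "w = I y" using m edge_in[OF uw(1)] unfolding marks_ok_def by auto
      then show "sat V E I J (Edge x y)" using uw by simp
    qed (use m in \<open>auto simp: marks_ok_def\<close>)
  qed
  then show ?case by blast
next
  case (Eq x y)
  have "recognizes k (Eq x y) (\<lambda>V E d M. \<exists>u\<in>V. 2 * x \<in> M u \<and> 2 * y \<in> M (u :: 'v))"
    by (rule recognizesI[OF recognizable_exists_vertex[where Q = "\<lambda>m. 2 * x \<in> m \<and> 2 * y \<in> m"]])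
       (auto simp: marks_ok_def)
  then show ?case by blast
next
  case (Mem x X)
  have "recognizes k (Mem x X) (\<lambda>V E d M. \<exists>u\<in>V. 2 * x \<in> M u \<and> Suc (2 * X) \<in> M (u :: 'v))"
    by (rule recognizesI[OF recognizable_exists_vertex[where Q = "\<lambda>m. 2 * x \<in> m \<and> Suc (2 * X) \<in> m"]])
       (auto simp: marks_ok_def)
  then show ?case by blast
next
  case (Neg \<phi>)
  then show ?case using recognizes_Neg by blast
next
  case (Conj \<phi> \<phi>')
  then show ?case using recognizes_Conj by blast
next
  case (Disj \<phi> \<phi>')
  then obtain P P' :: "'v set \<Rightarrow> ('v \<Rightarrow> 'v \<Rightarrow> bool) \<Rightarrow> ('v \<Rightarrow> nat) \<Rightarrow> ('v \<Rightarrow> nat set) \<Rightarrow> bool"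
    where "recognizes k \<phi> P" "recognizes k \<phi>' P'" by blast
  note recognizes_Neg[OF recognizes_Conj[OF this[THEN recognizes_Neg]]]
  from recognizes_transfer[OF this, where \<phi>' = "Disj \<phi> \<phi>'"] show ?case by auto
next
  case (ExV x \<phi>)
  then show ?case using recognizes_ExV by blast
next
  case (AllV x \<phi>)
  then obtain P :: "'v set \<Rightarrow> ('v \<Rightarrow> 'v \<Rightarrow> bool) \<Rightarrow> ('v \<Rightarrow> nat) \<Rightarrow> ('v \<Rightarrow> nat set) \<Rightarrow> bool"
    where "recognizes k \<phi> P" by blast
  note recognizes_Neg[OF recognizes_ExV[OF recognizes_Neg[OF this]]]
  from recognizes_transfer[OF this, where \<phi>' = "AllV x \<phi>"] show ?case by auto
next
  case (ExS X \<phi>)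
  then show ?case using recognizes_ExS by blast
next
  case (AllS X \<phi>)
  then obtain P :: "'v set \<Rightarrow> ('v \<Rightarrow> 'v \<Rightarrow> bool) \<Rightarrow> ('v \<Rightarrow> nat) \<Rightarrow> ('v \<Rightarrow> nat set) \<Rightarrow> bool"
    where "recognizes k \<phi> P" by blast
  note recognizes_Neg[OF recognizes_ExS[OF recognizes_Neg[OF this]]]
  from recognizes_transfer[OF this, where \<phi>' = "AllS X \<phi>"] show ?case by auto
qed

text \<open>With no free variables every marking is admissible, in particular the empty one that the
  local checks use.\<close>

lemma mso_sentence_automaton:
  assumes "mso_sentence \<psi>"
  obtains N f acc where "\<And>c S m X g. f c S m X g < (N :: nat)"
    and "\<And>c S m X g g'. (\<And>x. x \<in> X \<Longrightarrow> g x = g' x) \<Longrightarrow> f c S m X g = f c S m X g'"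
    and "\<And>(V :: 'v set) E \<kappa> r p d col a \<rho>. etree k V E \<kappa> r p d col a \<Longrightarrow>
        etree.run k V E \<kappa> r p col a f (\<lambda>_. {}) \<rho> \<Longrightarrow> acc (\<rho> (\<kappa> r)) \<longleftrightarrow> models V E \<psi>"
proof -
  obtain P :: "'v set \<Rightarrow> ('v \<Rightarrow> 'v \<Rightarrow> bool) \<Rightarrow> ('v \<Rightarrow> nat) \<Rightarrow> ('v \<Rightarrow> nat set) \<Rightarrow> bool"
    where P: "recognizes k \<psi> P" by (rule exE[OF mso_recognizable])
  have sent: "marks_ok \<psi> V I J M" for V :: "'v set" and I J M
    using assms by (simp add: marks_ok_def mso_sentence_def)
  from recognizesD(1)[OF P] obtain N f acc where *: "\<And>c S m X g. f c S m X g < (N :: nat)"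
    "\<And>c S m X g g'. (\<And>x. x \<in> X \<Longrightarrow> g x = g' x) \<Longrightarrow> f c S m X g = f c S m X g'"
    "\<And>(V :: 'v set) E \<kappa> r p d col a M \<rho>. etree k V E \<kappa> r p d col a \<Longrightarrow>
        etree.run k V E \<kappa> r p col a f M \<rho> \<Longrightarrow> acc (\<rho> (\<kappa> r)) \<longleftrightarrow> P V E d M"
    by (rule recognizableE) blast
  show thesis
  proof (rule that[of f N acc])
    fix V :: "'v set" and E \<kappa> r p d col a \<rho>
    assume e: "etree k V E \<kappa> r p d col a" and run: "etree.run k V E \<kappa> r p col a f (\<lambda>_. {}) \<rho>"
    show "acc (\<rho> (\<kappa> r)) \<longleftrightarrow> models V E \<psi>"
      unfolding models_def *(3)[OF e run] by (rule recognizesD(2)[OF P e sent])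
  qed (rule *(1), rule *(2), blast)
qed

section \<open>Local checks and soundness\<close>

text \<open>A vertex \<open>v\<close> publishes the record \<open>[id v, id (p v), depth, colour, state, a v 0, \<dots>, a v k]\<close>;
  identifiers start at 1, so 0 encodes a missing parent or ancestor.\<close>

definition rid :: "nat list \<Rightarrow> nat" where "rid R = R ! 0"
definition rpar :: "nat list \<Rightarrow> nat" where "rpar R = R ! 1"
definition rdep :: "nat list \<Rightarrow> nat" where "rdep R = R ! 2"
definition rcol :: "nat list \<Rightarrow> nat" where "rcol R = R ! 3"
definition rstate :: "nat list \<Rightarrow> nat" where "rstate R = R ! 4"
definition ranc :: "nat list \<Rightarrow> nat \<Rightarrow> nat" where "ranc R c = R ! (5 + c)"

text \<open>An item \<open>(m, x, R)\<close> says: this vertex has index \<open>m\<close> on the path that starts at the vertex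
  with record \<open>R\<close> and leads to its parent, and \<open>x\<close> is the identifier of the next vertex on it.\<close>

datatype label =
  Label (ldist: nat) (lroot: nat) (lrec: "nat list") (litems: "(nat \<times> nat \<times> nat list) list")

section \<open>The local checks\<close>

text \<open>The two ways a child's record becomes visible at \<open>i\<close>: the child is a
  neighbour, or a neighbour is the last vertex but one of the child's path and names
  \<open>i\<close> as the next vertex.\<close>

definition child_recs :: "nat \<Rightarrow> (nat \<times> label) set \<Rightarrow> nat list set" where
  "child_recs i Nb = {R. rpar R = i \<and> (\<exists>(j, l)\<in>Nb. R = lrec l \<or> (\<exists>m. (m, i, R) \<in> set (litems l)))}"

text \<open>Behind the clauses on items: the backward clause (index \<open>m - 1\<close>) rules out
  forged records, since tracing back ends at a vertex that publishes the record as its own; the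
  forward clause makes the record reach the parent; one index per starting identifier and
  \<open>rpar Q \<noteq> i\<close> keep the path from revisiting a vertex. The existential
  \<open>g\<close> forces child records with equal identifiers to show equal states.\<close>

definition accepts :: "nat \<Rightarrow> (nat \<Rightarrow> nat set \<Rightarrow> nat set \<Rightarrow> nat set \<Rightarrow> (nat \<Rightarrow> nat) \<Rightarrow> nat) \<Rightarrow> (nat \<Rightarrow> bool)
    \<Rightarrow> nat \<Rightarrow> label \<Rightarrow> (nat \<times> label) set \<Rightarrow> bool" where
  "accepts k f acc i l Nb \<longleftrightarrow> (let R = lrec l in
     rid R = i \<and>
     (if ldist l = 0 then i = 1 else \<exists>(j, l')\<in>Nb. Suc (ldist l') = ldist l) \<and>
     (\<forall>(j, l')\<in>Nb. lroot l' = lroot l) \<and>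
     (rpar R = 0 \<longleftrightarrow> i = lroot l) \<and>
     rcol R \<le> k \<and> ranc R (rcol R) = 0 \<and>
     (i = lroot l \<longrightarrow> rdep R = 0 \<and> (\<forall>c\<le>k. ranc R c = 0) \<and> acc (rstate R)) \<and>
     (rpar R \<noteq> 0 \<longrightarrow> (\<exists>(j, l')\<in>Nb. j = rpar R) \<or> (\<exists>x. (0, x, R) \<in> set (litems l))) \<and>
     length (litems l) \<le> k \<and>
     (\<forall>m x Q m' x' Q'. (m, x, Q) \<in> set (litems l) \<longrightarrow> (m', x', Q') \<in> set (litems l) \<longrightarrow>
        rid Q = rid Q' \<longrightarrow> m = m') \<and>
     (\<forall>m x Q. (m, x, Q) \<in> set (litems l) \<longrightarrow> rpar Q \<noteq> i \<and>
        (\<exists>(j, l')\<in>Nb. j = x \<and> (x = rpar Q \<or> (\<exists>y. (Suc m, y, Q) \<in> set (litems l')))) \<and>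
        (if m = 0 then Q = R else \<exists>(j, l')\<in>Nb. (m - 1, i, Q) \<in> set (litems l'))) \<and>
     (\<forall>(j, l')\<in>Nb. (\<exists>c\<le>k. ranc R c = j) \<or> (\<exists>c\<le>k. ranc (lrec l') c = i)) \<and>
     (\<forall>Q\<in>child_recs i Nb. rdep Q = Suc (rdep R) \<and>
        (\<forall>c\<le>k. ranc Q c \<noteq> 0 \<longrightarrow> ranc Q c = i \<and> c = rcol R \<or> ranc Q c = ranc R c)) \<and>
     (\<exists>g. (\<forall>Q\<in>child_recs i Nb. g (rid Q) = rstate Q) \<and>
        rstate R = f (rcol R) {c. c \<le> k \<and> (\<exists>(j, l')\<in>Nb. ranc R c = j)} {} (rid ` child_recs i Nb) g))"

section \<open>Consequences of acceptance\<close>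

locale accepted =
  fixes k :: nat and f acc and V :: "'v set" and E :: "'v \<Rightarrow> 'v \<Rightarrow> bool" and \<iota> :: "'v \<Rightarrow> nat"
    and \<Lambda> :: "'v \<Rightarrow> label"
  assumes graph: "simple_graph V E" and ident: "id_assignment V \<iota>"
    and ok: "v \<in> V \<Longrightarrow> accepts k f acc (\<iota> v) (\<Lambda> v) ((\<lambda>w. (\<iota> w, \<Lambda> w)) ` {w. E v w})"
begin

abbreviation "rec v \<equiv> lrec (\<Lambda> v)"
abbreviation "items v \<equiv> set (litems (\<Lambda> v))"
abbreviation "crecs v \<equiv> child_recs (\<iota> v) ((\<lambda>w. (\<iota> w, \<Lambda> w)) ` {w. E v w})"

lemma finV: "finite V" and neV: "V \<noteq> {}" using graph by (auto simp: simple_graph_def)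

lemma edgeD: "E u v \<Longrightarrow> u \<in> V \<and> v \<in> V \<and> u \<noteq> v \<and> E v u"
  using graph unfolding simple_graph_def by blast

lemma inj: "inj_on \<iota> V" and img: "\<iota> ` V = {1..card V}"
  using ident by (auto simp: id_assignment_def bij_betw_def)

lemma id_eq: "u \<in> V \<Longrightarrow> v \<in> V \<Longrightarrow> \<iota> u = \<iota> v \<longleftrightarrow> u = v"
  using inj by (auto dest: inj_onD)

lemma id_nz: "v \<in> V \<Longrightarrow> \<iota> v \<noteq> 0"
  using img by fastforce

lemma checks:
  assumes "v \<in> V"
  shows "rid (rec v) = \<iota> v"
    and "if ldist (\<Lambda> v) = 0 then \<iota> v = 1 else \<exists>w. E v w \<and> Suc (ldist (\<Lambda> w)) = ldist (\<Lambda> v)"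
    and "E v w \<Longrightarrow> lroot (\<Lambda> w) = lroot (\<Lambda> v)"
    and "rpar (rec v) = 0 \<longleftrightarrow> \<iota> v = lroot (\<Lambda> v)"
    and "rcol (rec v) \<le> k" and "ranc (rec v) (rcol (rec v)) = 0"
    and "\<iota> v = lroot (\<Lambda> v) \<Longrightarrow> rdep (rec v) = 0 \<and> (\<forall>c\<le>k. ranc (rec v) c = 0) \<and> acc (rstate (rec v))"
    and "rpar (rec v) \<noteq> 0 \<Longrightarrow> (\<exists>w. E v w \<and> \<iota> w = rpar (rec v)) \<or> (\<exists>x. (0, x, rec v) \<in> items v)"
    and "length (litems (\<Lambda> v)) \<le> k"
    and "(m, x, Q) \<in> items v \<Longrightarrow> (m', x', Q') \<in> items v \<Longrightarrow> rid Q = rid Q' \<Longrightarrow> m = m'"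
    and "(m, x, Q) \<in> items v \<Longrightarrow> rpar Q \<noteq> \<iota> v"
    and "(m, x, Q) \<in> items v \<Longrightarrow>
      \<exists>w. E v w \<and> \<iota> w = x \<and> (x = rpar Q \<or> (\<exists>y. (Suc m, y, Q) \<in> items w))"
    and "(m, x, Q) \<in> items v \<Longrightarrow> if m = 0 then Q = rec v else \<exists>w. E v w \<and> (m - 1, \<iota> v, Q) \<in> items w"
    and "E v w \<Longrightarrow> (\<exists>c\<le>k. ranc (rec v) c = \<iota> w) \<or> (\<exists>c\<le>k. ranc (rec w) c = \<iota> v)"
    and "Q \<in> crecs v \<Longrightarrow> rdep Q = Suc (rdep (rec v))"
    and "Q \<in> crecs v \<Longrightarrow> c \<le> k \<Longrightarrow> ranc Q c \<noteq> 0 \<Longrightarrow>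
      ranc Q c = \<iota> v \<and> c = rcol (rec v) \<or> ranc Q c = ranc (rec v) c"
    and "\<exists>g. (\<forall>Q\<in>crecs v. g (rid Q) = rstate Q) \<and> rstate (rec v) =
      f (rcol (rec v)) {c. c \<le> k \<and> (\<exists>w. E v w \<and> ranc (rec v) c = \<iota> w)} {} (rid ` crecs v) g"
proof -
  note * = ok[OF assms, unfolded accepts_def Let_def bex_simps ball_simps mem_Collect_eq prod.case]
  note c1 = conjunct1[OF *] note s1 = conjunct2[OF *]
  note c2 = conjunct1[OF s1] note s2 = conjunct2[OF s1]
  note c3 = conjunct1[OF s2] note s3 = conjunct2[OF s2]
  note c4 = conjunct1[OF s3] note s4 = conjunct2[OF s3]
  note c5 = conjunct1[OF s4] note s5 = conjunct2[OF s4]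
  note c6 = conjunct1[OF s5] note s6 = conjunct2[OF s5]
  note c7 = conjunct1[OF s6] note s7 = conjunct2[OF s6]
  note c8 = conjunct1[OF s7] note s8 = conjunct2[OF s7]
  note c9 = conjunct1[OF s8] note s9 = conjunct2[OF s8]
  note c10 = conjunct1[OF s9] note s10 = conjunct2[OF s9]
  note c11 = conjunct1[OF s10] note s11 = conjunct2[OF s10]
  note c12 = conjunct1[OF s11] note s12 = conjunct2[OF s11]
  note c13 = conjunct1[OF s12] note c14 = conjunct2[OF s12]
  show "rid (rec v) = \<iota> v" by (rule c1)
  show "if ldist (\<Lambda> v) = 0 then \<iota> v = 1 else \<exists>w. E v w \<and> Suc (ldist (\<Lambda> w)) = ldist (\<Lambda> v)"
    using c2 by auto
  show "E v w \<Longrightarrow> lroot (\<Lambda> w) = lroot (\<Lambda> v)" using c3 by auto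
  show "rpar (rec v) = 0 \<longleftrightarrow> \<iota> v = lroot (\<Lambda> v)" by (rule c4)
  show "rcol (rec v) \<le> k" by (rule c5)
  show "ranc (rec v) (rcol (rec v)) = 0" by (rule c6)
  show "\<iota> v = lroot (\<Lambda> v) \<Longrightarrow> rdep (rec v) = 0 \<and> (\<forall>c\<le>k. ranc (rec v) c = 0) \<and> acc (rstate (rec v))"
    using c7 by simp
  show "rpar (rec v) \<noteq> 0 \<Longrightarrow> (\<exists>w. E v w \<and> \<iota> w = rpar (rec v)) \<or> (\<exists>x. (0, x, rec v) \<in> items v)"
    using c8 by auto
  show "length (litems (\<Lambda> v)) \<le> k" by (rule c9)
  show "(m, x, Q) \<in> items v \<Longrightarrow> (m', x', Q') \<in> items v \<Longrightarrow> rid Q = rid Q' \<Longrightarrow> m = m'"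
    using c10 by blast
  show "(m, x, Q) \<in> items v \<Longrightarrow> rpar Q \<noteq> \<iota> v" using c11 by blast
  show "(m, x, Q) \<in> items v \<Longrightarrow>
      \<exists>w. E v w \<and> \<iota> w = x \<and> (x = rpar Q \<or> (\<exists>y. (Suc m, y, Q) \<in> items w))" using c11 by blast
  show "(m, x, Q) \<in> items v \<Longrightarrow> if m = 0 then Q = rec v else \<exists>w. E v w \<and> (m - 1, \<iota> v, Q) \<in> items w"
    using c11 by (auto split: if_splits)
  show "E v w \<Longrightarrow> (\<exists>c\<le>k. ranc (rec v) c = \<iota> w) \<or> (\<exists>c\<le>k. ranc (rec w) c = \<iota> v)"
    using c12 by auto
  show "Q \<in> crecs v \<Longrightarrow> rdep Q = Suc (rdep (rec v))" using c13 by blast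
  show "Q \<in> crecs v \<Longrightarrow> c \<le> k \<Longrightarrow> ranc Q c \<noteq> 0 \<Longrightarrow>
      ranc Q c = \<iota> v \<and> c = rcol (rec v) \<or> ranc Q c = ranc (rec v) c" using c13 by blast
  have "{c. c \<le> k \<and> (\<exists>x. E v x \<and> ranc (rec v) c = \<iota> x)} =
    {c. c \<le> k \<and> (\<exists>(j, l')\<in>(\<lambda>w. (\<iota> w, \<Lambda> w)) ` {w. E v w}. ranc (rec v) c = j)}" by auto
  then show "\<exists>g. (\<forall>Q\<in>crecs v. g (rid Q) = rstate Q) \<and> rstate (rec v) =
      f (rcol (rec v)) {c. c \<le> k \<and> (\<exists>w. E v w \<and> ranc (rec v) c = \<iota> w)} {} (rid ` crecs v) g"
    using c14 by simp
qed

text \<open>A vertex with positive \<open>ldist\<close> has a neighbour whose value is one smaller,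
  and 0 occurs only at the vertex with identifier 1. Identifiers are a bijection onto
  \<open>{1..card V}\<close>, so that vertex exists once and every vertex is joined to it.\<close>

lemma connected: "connected_graph V E"
proof -
  let ?e = "\<lambda>u v. u \<in> V \<and> v \<in> V \<and> E u v"
  obtain o' where o': "o' \<in> V" "\<iota> o' = 1"
  proof -
    have "card V \<ge> 1" using finV neV by (simp add: Suc_le_eq card_gt_0_iff)
    then have "1 \<in> \<iota> ` V" using img by auto
    then show thesis using that by auto
  qed
  have to: "reach V E v o'" if "v \<in> V" for v
    using that
  proof (induction "ldist (\<Lambda> v)" arbitrary: v)
    case 0
    then have "\<iota> v = 1" using checks(2)[of v] by auto
    then have "v = o'" using 0 o' id_eq[of v o'] by auto
    then show ?case by (simp add: reach_def)
  next
    case (Suc n)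
    then obtain w where w: "E v w" "Suc (ldist (\<Lambda> w)) = ldist (\<Lambda> v)" using checks(2)[of v] by auto
    then have "reach V E w o'" using Suc edgeD[of v w] by auto
    then show ?case using w edgeD[of v w] unfolding reach_def by (auto intro: converse_rtranclp_into_rtranclp)
  qed
  have sym: "symp ?e" using edgeD by (auto intro: sympI)
  have from_o: "reach V E o' v" if "v \<in> V" for v
    using to[OF that] symp_rtranclp[OF sym] unfolding reach_def by (blast dest: sympD)
  show ?thesis unfolding connected_graph_def
    using neV to from_o unfolding reach_def by (blast intro: rtranclp_trans)
qed

lemma roots_eq: "u \<in> V \<Longrightarrow> v \<in> V \<Longrightarrow> lroot (\<Lambda> u) = lroot (\<Lambda> v)"
proof -
  assume "u \<in> V" "v \<in> V"
  then have "reach V E u v" using connected by (auto simp: connected_graph_def)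
  then show ?thesis unfolding reach_def
    by (induction rule: rtranclp_induct) (auto simp: checks(3))
qed

text \<open>Indices fall along the backward clause, and at index 0 the record must be the vertex's
  own; so every circulating record is published by a real vertex.\<close>

lemma item_origin: "v \<in> V \<Longrightarrow> (m, x, Q) \<in> items v \<Longrightarrow> \<exists>s\<in>V. Q = rec s"
proof (induction m arbitrary: v x)
  case 0
  then show ?case using checks(13)[of v 0 x Q] by auto
next
  case (Suc m)
  then obtain w where "E v w" "(m, \<iota> v, Q) \<in> items w" using checks(13)[of v "Suc m" x Q] by auto
  then show ?case using Suc.IH[of w] edgeD by blast
qed

text \<open>The forward clause increases the index at every step and indices are bounded in a finite
  graph, so the walk must end, which it can only do at the parent. The last conjunct says that the
  parent sees the record at a neighbour.\<close>

lemma item_path: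
  assumes "u \<in> V" "(m, x, Q) \<in> items u"
  shows "\<exists>P. P \<noteq> [] \<and> hd P = u \<and> (\<forall>i. Suc i < length P \<longrightarrow> E (P ! i) (P ! Suc i) \<and>
      (\<exists>y. (m + i, y, Q) \<in> items (P ! i))) \<and> last P \<in> V \<and> \<iota> (last P) = rpar Q \<and>
      (\<exists>w m. E (last P) w \<and> (m, rpar Q, Q) \<in> items w)"
proof -
  define B where "B = Max (\<Union>v\<in>V. fst ` items v)"
  have B: "m \<le> B" if "v \<in> V" "(m, x, Q) \<in> items v" for v m x Q
    unfolding B_def using finV that by (intro Max_ge) force+
  from assms show ?thesis
  proof (induction "Suc B - m" arbitrary: u m x rule: less_induct)
    case less
    obtain w where w: "E u w" "\<iota> w = x" "x = rpar Q \<or> (\<exists>y. (Suc m, y, Q) \<in> items w)"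
      using checks(12)[OF less.prems] by blast
    have wV: "w \<in> V" "E w u" using edgeD w by blast+
    show ?case
    proof (cases "x = rpar Q")
      case True
      have "\<exists>v m. E w v \<and> (m, rpar Q, Q) \<in> items v"
        using wV(2) less.prems(2) True by auto
      then show ?thesis using w less.prems wV True
        by (intro exI[of _ "[u, w]"]) auto
    next
      case False
      then obtain y where y: "(Suc m, y, Q) \<in> items w" using w by blast
      have "Suc B - Suc m < Suc B - m" using B[OF less.prems] by linarith
      then obtain P where P: "P \<noteq> []" "hd P = w" "\<forall>i. Suc i < length P \<longrightarrow> E (P ! i) (P ! Suc i) \<and>
        (\<exists>y. (Suc m + i, y, Q) \<in> items (P ! i))" "last P \<in> V" "\<iota> (last P) = rpar Q"
        "\<exists>w m. E (last P) w \<and> (m, rpar Q, Q) \<in> items w"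
        using less.hyps[OF _ wV(1) y] by blast
      have "E ((u # P) ! i) ((u # P) ! Suc i) \<and> (\<exists>y. (m + i, y, Q) \<in> items ((u # P) ! i))"
        if "Suc i < length (u # P)" for i
      proof (cases i)
        case 0
        then show ?thesis using w P(1,2) less.prems by (auto simp: hd_conv_nth)
      next
        case (Suc j)
        then show ?thesis using P(3)[rule_format, of j] that by auto
      qed
      then show ?thesis using P by (intro exI[of _ "u # P"]) simp
    qed
  qed
qed

definition par where "par v = inv_into V \<iota> (rpar (rec v))"

lemma parI: "u \<in> V \<Longrightarrow> \<iota> u = rpar (rec v) \<Longrightarrow> par v = u"
  unfolding par_def using inj by (metis inv_into_f_f)

lemma parent:
  assumes "v \<in> V" "rpar (rec v) \<noteq> 0"
  shows "par v \<in> V \<and> \<iota> (par v) = rpar (rec v) \<and> rec v \<in> crecs (par v)"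
  using checks(8)[OF assms]
proof (elim disjE exE conjE)
  fix w assume w: "E v w" "\<iota> w = rpar (rec v)"
  then have "w \<in> V" "E w v" using edgeD by blast+
  then have "par v = w" using parI w by simp
  then show ?thesis using w \<open>w \<in> V\<close> \<open>E w v\<close> by (auto simp: child_recs_def)
next
  fix x assume "(0, x, rec v) \<in> items v"
  from item_path[OF assms(1) this] obtain P w m where P: "last P \<in> V" "\<iota> (last P) = rpar (rec v)"
    "E (last P) w" "(m, rpar (rec v), rec v) \<in> items w" by blast
  then have "par v = last P" using parI by simp
  then show ?thesis using P by (auto simp: child_recs_def)
qed

text \<open>No record is forged, by \<open>item_origin\<close>, and none is lost, by
  \<open>parent\<close>.\<close>

lemma crecs_eq:
  assumes "v \<in> V"
  shows "crecs v = rec ` {s \<in> V. rpar (rec s) = \<iota> v}"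
proof (intro equalityI subsetI)
  fix Q assume "Q \<in> crecs v"
  then obtain w where "rpar Q = \<iota> v" "E v w" "Q = rec w \<or> (\<exists>m. (m, \<iota> v, Q) \<in> items w)"
    by (auto simp: child_recs_def)
  moreover from this have "\<exists>s\<in>V. Q = rec s" using edgeD[of v w] item_origin[of w] by auto
  ultimately show "Q \<in> rec ` {s \<in> V. rpar (rec s) = \<iota> v}" by auto
next
  fix Q assume "Q \<in> rec ` {s \<in> V. rpar (rec s) = \<iota> v}"
  then obtain s where s: "s \<in> V" "rpar (rec s) = \<iota> v" "Q = rec s" by auto
  then have "par s = v" using parI assms by simp
  then show "Q \<in> crecs v" using parent[of s] s id_nz[OF assms] by auto
qed

lemma depth_parent:
  assumes "v \<in> V" "rpar (rec v) \<noteq> 0"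
  shows "rdep (rec v) = Suc (rdep (rec (par v)))"
  using parent[OF assms] checks(15) by blast

text \<open>No single view shows that \<open>lroot\<close> is the identifier of a vertex. A vertex
  of least depth provides it, since a parent would have smaller depth.\<close>

lemma root_exists: "\<exists>r\<in>V. \<iota> r = lroot (\<Lambda> r)"
proof -
  obtain r where r: "r \<in> V" "\<And>v. v \<in> V \<Longrightarrow> rdep (rec r) \<le> rdep (rec v)"
    using arg_min_if_finite[OF finV neV, of "\<lambda>v. rdep (rec v)"] by (meson not_le)
  have "rpar (rec r) = 0"
  proof (rule ccontr)
    assume "rpar (rec r) \<noteq> 0"
    then show False using depth_parent[OF r(1)] parent[OF r(1)] r(2)[of "par r"] by auto
  qed
  then show ?thesis using checks(4) r by blast
qed

definition root where "root = (SOME r. r \<in> V \<and> \<iota> r = lroot (\<Lambda> r))"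

lemma root: "root \<in> V" "\<iota> root = lroot (\<Lambda> root)"
  using root_exists unfolding root_def by (metis (mono_tags, lifting) someI_ex)+

lemma rpar_0_iff: "v \<in> V \<Longrightarrow> rpar (rec v) = 0 \<longleftrightarrow> v = root"
  using checks(4)[of v] root roots_eq[of v root] id_eq[of v root] by metis

sublocale etree k V E \<iota> root par "\<lambda>v. rdep (rec v)" "\<lambda>v. rcol (rec v)" "\<lambda>v. ranc (rec v)"
proof
  show "finite V" by (rule finV)
  show "root \<in> V" by (rule root)
  show "rdep (rec root) = 0" using checks(7)[OF root] by blast
  show "inj_on \<iota> V" by (rule inj)
next
  fix v assume v: "v \<in> V"
  show "\<iota> v \<noteq> 0" "rcol (rec v) \<le> k" "ranc (rec v) (rcol (rec v)) = 0"
    using id_nz checks(5,6) v by auto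
  assume "v \<noteq> root"
  then have nz: "rpar (rec v) \<noteq> 0" using rpar_0_iff v by blast
  note pv = parent[OF v nz]
  show "par v \<in> V" "rdep (rec v) = Suc (rdep (rec (par v)))" using pv depth_parent[OF v nz] by auto
  fix c assume "c \<le> k" "ranc (rec v) c \<noteq> 0"
  then show "ranc (rec v) c = \<iota> (par v) \<and> c = rcol (rec (par v)) \<or> ranc (rec v) c = ranc (rec (par v)) c"
    using checks(16)[of "par v" "rec v" c] pv by auto
next
  fix u v assume "E u v"
  then show "u \<in> V \<and> v \<in> V \<and> E v u" using edgeD by blast
  show "(\<exists>c\<le>k. ranc (rec v) c = \<iota> u) \<or> (\<exists>c\<le>k. ranc (rec u) c = \<iota> v)"
    using checks(14)[of u v] edgeD[OF \<open>E u v\<close>] \<open>E u v\<close> by blast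
next
  fix c assume "c \<le> k"
  then show "ranc (rec root) c = 0" using checks(7)[OF root] by blast
qed

lemma children_eq: "v \<in> V \<Longrightarrow> children v = {s \<in> V. rpar (rec s) = \<iota> v}"
  unfolding children_def using rpar_0_iff parent parI id_nz by metis

text \<open>The last clause gives each vertex its own \<open>g\<close>. All of them agree with the
  published states on the children, so by extensionality one global assignment replaces
  them.\<close>

lemma run_labels:
  assumes ext: "\<And>c S m X g g'. (\<And>x. x \<in> X \<Longrightarrow> g x = g' x) \<Longrightarrow> f c S m X g = f c S m X g'"
  shows "run f (\<lambda>_. {}) (\<lambda>x. rstate (rec (inv_into V \<iota> x)))"
  unfolding run_def
proof
  fix v assume v: "v \<in> V"
  let ?\<rho> = "\<lambda>x. rstate (rec (inv_into V \<iota> x))"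
  have \<rho>: "?\<rho> (\<iota> u) = rstate (rec u)" if "u \<in> V" for u using that inj by simp
  have ids: "rid ` crecs v = \<iota> ` children v"
    unfolding crecs_eq[OF v] children_eq[OF v] using checks(1) by force
  obtain g where g: "\<forall>Q\<in>crecs v. g (rid Q) = rstate Q" "rstate (rec v) =
      f (rcol (rec v)) {c. c \<le> k \<and> (\<exists>w. E v w \<and> ranc (rec v) c = \<iota> w)} {} (rid ` crecs v) g"
    using checks(17)[OF v] by blast
  have "g x = ?\<rho> x" if "x \<in> \<iota> ` children v" for x
  proof -
    from that obtain s where s: "x = \<iota> s" "s \<in> V" "rpar (rec s) = \<iota> v" unfolding children_eq[OF v] by auto
    then have "rec s \<in> crecs v" unfolding crecs_eq[OF v] by auto
    then have "g (rid (rec s)) = rstate (rec s)" using g(1) by blast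
    then show ?thesis using s checks(1) \<rho> by simp
  qed
  then have "f (rcol (rec v)) (up_cols v) {} (\<iota> ` children v) g =
      f (rcol (rec v)) (up_cols v) {} (\<iota> ` children v) ?\<rho>" by (rule ext)
  then show "?\<rho> (\<iota> v) = f (rcol (rec v)) (up_cols v) {} (\<iota> ` children v) ?\<rho>"
    unfolding \<rho>[OF v] using g(2) unfolding ids up_cols_def by simp
qed

lemma acc_root: "acc (rstate (rec root))"
  using checks(7)[OF root] by blast

text \<open>The walks from \<open>item_path\<close> are simple: a repeated vertex would store one
  start under two indices, or be the parent storing an item of its own child. Paths that count at
  \<open>u\<close> have distinct starts and leave items with distinct \<open>rid\<close> at
  \<open>u\<close>, so the congestion is at most the number of items.\<close>

lemma path_system_exists:
  "\<exists>S. path_system V E S \<and> congestion_le V S (int k) \<and> witnesses V E S root par"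
proof -
  define good where "good s P \<longleftrightarrow> P \<noteq> [] \<and> hd P = s \<and> (\<forall>i. Suc i < length P \<longrightarrow> E (P ! i) (P ! Suc i) \<and>
      (\<exists>y. (i, y, rec s) \<in> items (P ! i))) \<and> last P = par s" for s P
  define T where "T = {s \<in> V. s \<noteq> root \<and> \<not> E s (par s)}"
  have "\<exists>P. good s P" if "s \<in> T" for s
  proof -
    have s: "s \<in> V" "s \<noteq> root" "\<not> E s (par s)" using that by (auto simp: T_def)
    then have nz: "rpar (rec s) \<noteq> 0" using rpar_0_iff by blast
    have "\<not> (\<exists>w. E s w \<and> \<iota> w = rpar (rec s))" using parI s(3) edgeD by metis
    then obtain x where "(0, x, rec s) \<in> items s" using checks(8)[OF s(1) nz] by blast
    from item_path[OF s(1) this] obtain P where "P \<noteq> []" "hd P = s"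
      "\<forall>i. Suc i < length P \<longrightarrow> E (P ! i) (P ! Suc i) \<and> (\<exists>y. (0 + i, y, rec s) \<in> items (P ! i))"
      "last P \<in> V" "\<iota> (last P) = rpar (rec s)" by blast
    then show ?thesis using parI[of "last P" s] unfolding good_def by auto
  qed
  then obtain path where path: "\<And>s. s \<in> T \<Longrightarrow> good s (path s)" by metis
  have hdp: "hd (path s) = s" if "s \<in> T" for s using path[OF that] by (simp add: good_def)
  have TV: "s \<in> V" "rpar (rec s) \<noteq> 0" if "s \<in> T" for s using that rpar_0_iff by (auto simp: T_def)
  have item: "\<exists>m y. (m, y, rec s) \<in> items u" if "s \<in> T" "u \<in> set (butlast (path s))" for s u
  proof -
    from that(2) obtain i where "i < length (butlast (path s))" "butlast (path s) ! i = u"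
      by (auto simp: in_set_conv_nth)
    then have "Suc i < length (path s)" "path s ! i = u" by (auto simp: nth_butlast)
    then show ?thesis using path[OF that(1)] unfolding good_def by blast
  qed
  have or: "oriented_path V E (path s)" if s: "s \<in> T" for s
  proof -
    let ?P = "path s"
    have ne: "?P \<noteq> []" and lst: "last ?P = par s" and
      g: "\<And>i. Suc i < length ?P \<Longrightarrow> E (?P ! i) (?P ! Suc i) \<and> (\<exists>y. (i, y, rec s) \<in> items (?P ! i))"
      using path[OF s] unfolding good_def by blast+
    have inV: "?P ! i \<in> V" if "i < length ?P" for i
    proof (cases "Suc i < length ?P")
      case True then show ?thesis using g edgeD by blast
    next
      case False
      then have "i = length ?P - 1" using that by linarith
      then have "?P ! i = par s" using ne lst by (simp add: last_conv_nth)
      then show ?thesis using parent[OF TV[OF s]] by simp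
    qed
    have "?P ! i \<noteq> ?P ! j" if ij: "i < j" "j < length ?P" for i j
    proof
      assume eq: "?P ! i = ?P ! j"
      have i: "?P ! i \<in> V" using inV ij by simp
      obtain y where y: "(i, y, rec s) \<in> items (?P ! i)" using g[of i] ij by auto
      show False
      proof (cases "Suc j < length ?P")
        case True
        then obtain y' where "(j, y', rec s) \<in> items (?P ! j)" using g by blast
        then show False using checks(10)[OF i y, of j y' "rec s"] eq ij by auto
      next
        case False
        then have "j = length ?P - 1" using ij by linarith
        then have "?P ! j = par s" using ne lst by (simp add: last_conv_nth)
        then have "\<iota> (?P ! i) = rpar (rec s)" using eq parent[OF TV[OF s]] by simp
        then show False using checks(11)[OF i y] by simp
      qed
    qed
    then have "distinct ?P" unfolding distinct_conv_nth by (metis linorder_neqE_nat)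
    moreover have "set ?P \<subseteq> V" using inV by (auto simp: in_set_conv_nth)
    ultimately show ?thesis unfolding oriented_path_def using ne g by blast
  qed
  have "congestion_at (path ` T) u \<le> k" if u: "u \<in> V" for u
  proof -
    let ?X = "{P \<in> path ` T. u \<in> set (butlast P)}"
    have "inj_on (\<lambda>P. \<iota> (hd P)) ?X"
    proof (rule inj_onI)
      fix P P' assume "P \<in> ?X" "P' \<in> ?X" and eq: "\<iota> (hd P) = \<iota> (hd P')"
      then obtain s s' where "s \<in> T" "s' \<in> T" "P = path s" "P' = path s'" by auto
      then show "P = P'" using eq hdp TV id_eq by metis
    qed
    moreover have "(\<lambda>P. \<iota> (hd P)) ` ?X \<subseteq> (\<lambda>(m, x, Q). rid Q) ` items u"
    proof clarify
      fix s assume s: "s \<in> T" "u \<in> set (butlast (path s))"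
      then obtain m y where "(m, y, rec s) \<in> items u" using item by blast
      then show "\<iota> (hd (path s)) \<in> (\<lambda>(m, x, Q). rid Q) ` items u"
        using hdp[OF s(1)] checks(1)[OF TV(1)[OF s(1)]] by force
    qed
    ultimately have "card ?X \<le> card ((\<lambda>(m, x, Q). rid Q) ` items u)"
      by (rule card_inj_on_le) simp
    also have "\<dots> \<le> card (items u)" by (rule card_image_le) simp
    also have "\<dots> \<le> length (litems (\<Lambda> u))" by (rule card_length)
    also have "\<dots> \<le> k" by (rule checks(9)[OF u])
    finally show ?thesis unfolding congestion_at_def .
  qed
  moreover have "witnesses V E (path ` T) root par"
    unfolding witnesses_def
  proof
    fix v assume v: "v \<in> V - {root}"
    show "E v (par v) \<or> (\<exists>P\<in>path ` T. hd P = v \<and> last P = par v)"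
    proof (cases "E v (par v)")
      case False
      then have "v \<in> T" using v by (auto simp: T_def)
      then show ?thesis using path[of v] unfolding good_def by blast
    qed simp
  qed
  ultimately show ?thesis
    using or by (intro exI[of _ "path ` T"]) (auto simp: path_system_def congestion_le_def)
qed

end

lemma connected_component: "connected_graph V E \<Longrightarrow> x \<in> V \<Longrightarrow> component V E x = V"
  by (auto simp: component_def connected_graph_def)

lemma restrict_edges_self: "simple_graph V E \<Longrightarrow> restrict_edges V E = E"
  by (auto simp: restrict_edges_def simple_graph_def fun_eq_iff)

lemma lv_treewidth_connected:
  assumes "simple_graph V E" "connected_graph V E"
  shows "lv_treewidth_le V E k \<longleftrightarrow> (\<exists>r p S. elimination_tree V E r p \<and> width_le V E r p k \<and>
    path_system V E S \<and> congestion_le V S k \<and> witnesses V E S r p)"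
proof -
  have "\<exists>x. x \<in> V" using assms(1) by (auto simp: simple_graph_def)
  then show ?thesis
    unfolding lv_treewidth_le_def Let_def
    by (auto simp: connected_component[OF assms(2)] restrict_edges_self[OF assms(1)])
qed

lemma (in accepted) lv_treewidth: "lv_treewidth_le V E (int k)"
  unfolding lv_treewidth_connected[OF graph connected]
  using elim_tree width path_system_exists by blast

section \<open>Completeness\<close>

text \<open>Acyclicity is hidden in the inductive \<open>anc\<close>, which makes every vertex reach
  \<open>r\<close> in finitely many parent steps. The least such number is the depth.\<close>

lemma tree_depth_exists:
  assumes "rooted_tree V r p"
  shows "\<exists>d. d r = (0 :: nat) \<and> (\<forall>v\<in>V. v \<noteq> r \<longrightarrow> d v = Suc (d (p v)))"
proof -
  define d where "d v = (LEAST n. (p ^^ n) v = r)" for v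
  have "\<exists>n. (p ^^ n) v = u" if "anc V r p u v" for u v
    using that
  proof (induction rule: anc.induct)
    case (anc_refl v)
    show ?case by (rule exI[of _ 0]) simp
  next
    case (anc_step v u)
    then obtain n where "(p ^^ n) (p v) = u" by blast
    then show ?case by (intro exI[of _ "Suc n"]) (simp add: funpow_swap1)
  qed
  then have ex: "\<exists>n. (p ^^ n) v = r" if "v \<in> V" for v
    using assms that by (auto simp: rooted_tree_def)
  have "d v = Suc (d (p v))" if v: "v \<in> V" "v \<noteq> r" for v
  proof -
    obtain n where "(p ^^ n) v = r" using ex v(1) by blast
    then have "(LEAST n. (p ^^ n) v = r) = Suc (LEAST n. (p ^^ Suc n) v = r)"
      by (rule Least_Suc) (use v(2) in simp)
    then show ?thesis by (simp add: d_def funpow_swap1)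
  qed
  moreover have "d r = 0" unfolding d_def by (rule Least_eq_0) simp
  ultimately show ?thesis by blast
qed

text \<open>By descent all values from 0 to \<open>d v\<close> are attained, which takes more than
  \<open>d v\<close> vertices. Serves both tree depths and distances.\<close>

lemma rank_less_card:
  assumes fin: "finite V" and step: "\<And>v. v \<in> V \<Longrightarrow> d v \<noteq> (0 :: nat) \<Longrightarrow> \<exists>w\<in>V. Suc (d w) = d v"
    and v: "v \<in> V"
  shows "d v < card V"
proof -
  have "{..d v} \<subseteq> d ` V"
    using v
  proof (induction "d v" arbitrary: v)
    case 0
    then show ?case by force
  next
    case (Suc n)
    then obtain w where w: "w \<in> V" "Suc (d w) = d v" using step[of v] by auto
    then have "n = d w" using Suc.hyps(2) by simp
    then have "{..n} \<subseteq> d ` V" using Suc.hyps(1)[of w] w by simp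
    moreover have "{..d v} = insert (d v) {..n}" using Suc(2) by (simp add: atMost_Suc flip: Suc(2))
    ultimately show ?case using Suc.prems by auto
  qed
  then have "card {..d v} \<le> card (d ` V)" using fin by (intro card_mono) auto
  also have "\<dots> \<le> card V" using fin by (rule card_image_le)
  finally show ?thesis by simp
qed

context rooted
begin

lemma anc_linear: "below u v \<Longrightarrow> below u' v \<Longrightarrow> below u u' \<or> below u' u"
proof (induction rule: anc.induct)
  case (anc_step v u)
  from anc_step.prems show ?case
  proof cases
    case anc_refl
    then show ?thesis using anc_step by (auto intro: anc.intros)
  next
    case anc_step
    then show ?thesis using \<open>below u' (p v) \<Longrightarrow> below u u' \<or> below u' u\<close> by simp
  qed
qed simp

lemma depth_less_card: "v \<in> V \<Longrightarrow> d v < card V"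
  by (rule rank_less_card[OF fin]) (use par_in depth_par depth_root in metis)

lemma strv_strict:
  assumes "v \<in> V" "u \<in> strv V E r p v - {v}"
  shows "u \<in> V \<and> below u v \<and> d u < d v"
  using assms anc_depth[of u v] by (auto simp: strv_def)

text \<open>The neighbour of \<open>u\<close> below \<open>v\<close> is also below \<open>w\<close>.
  This monotonicity makes slots inheritable and colours within str(v) distinct.\<close>

lemma strv_mono:
  assumes "u \<in> strv V E r p v - {v}" "below w v" "below u w" "u \<noteq> w"
  shows "u \<in> strv V E r p w - {w}"
  using assms anc_trans by (auto simp: strv_def subtree_def)

text \<open>Greedy by depth: the strict part of str(v) has at most \<open>k\<close> members, all of
  smaller depth and hence already coloured, so one of the \<open>k + 1\<close> colours is
  free.\<close>

lemma colouring_exists: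
  assumes width: "width_le V E r p (int k)"
  shows "\<exists>col. \<forall>v\<in>V. col v \<le> k \<and> (\<forall>u\<in>strv V E r p v - {v}. col u \<noteq> (col v :: nat))"
proof -
  have "\<exists>col. \<forall>v\<in>V. d v < n \<longrightarrow> col v \<le> k \<and> (\<forall>u\<in>strv V E r p v - {v}. col u \<noteq> (col v :: nat))" for n
  proof (induction n)
    case (Suc n)
    then obtain col where col:
      "\<And>v. v \<in> V \<Longrightarrow> d v < n \<Longrightarrow> col v \<le> k \<and> (\<forall>u\<in>strv V E r p v - {v}. col u \<noteq> (col v :: nat))"
      by blast
    have "\<exists>c\<le>k. c \<notin> col ` (strv V E r p v - {v})" if "v \<in> V" for v
    proof (rule ccontr)
      assume "\<not> (\<exists>c\<le>k. c \<notin> col ` (strv V E r p v - {v}))"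
      then have "{..k} \<subseteq> col ` (strv V E r p v - {v})" by auto
      moreover have f: "finite (strv V E r p v)" using fin by (simp add: strv_def)
      ultimately have "card {..k} \<le> card (strv V E r p v - {v})"
        by (meson card_image_le card_mono finite_Diff finite_imageI le_trans)
      also have "\<dots> = card (strv V E r p v) - 1" using f by (simp add: strv_def)
      finally show False using width that unfolding width_le_def by fastforce
    qed
    then obtain new where new: "\<And>v. v \<in> V \<Longrightarrow> new v \<le> k \<and> new v \<notin> col ` (strv V E r p v - {v})"
      by metis
    define col' where "col' v = (if d v = n then new v else col v)" for v
    have "col' v \<le> k \<and> (\<forall>u\<in>strv V E r p v - {v}. col' u \<noteq> col' v)" if v: "v \<in> V" "d v < Suc n" for v
    proof -
      have "col' u = col u" if "u \<in> strv V E r p v - {v}" for u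
        using strv_strict[OF v(1) that] v(2) by (auto simp: col'_def)
      moreover have "col' v = (if d v = n then new v else col v)" by (simp add: col'_def)
      moreover have "\<forall>u\<in>strv V E r p v - {v}. col u \<noteq> new v" using new[OF v(1)] by force
      ultimately show ?thesis using new[OF v(1)] col[OF v(1)] v(2) by auto
    qed
    then show ?case by blast
  qed simp
  from this[of "card V"] show ?thesis using depth_less_card by blast
qed

end

lemma etree_exists:
  assumes g: "simple_graph V E" and \<iota>: "id_assignment V \<iota>"
    and el: "elimination_tree V E r p" and width: "width_le V E r p (int k)"
  shows "\<exists>d col a. etree k V E \<iota> r p d col a \<and> (\<forall>v c. a v c \<le> card V)"
proof -
  have rt: "rooted_tree V r p" using el by (simp add: elimination_tree_def)
  obtain d where d: "d r = 0" "\<And>v. v \<in> V \<Longrightarrow> v \<noteq> r \<Longrightarrow> d v = Suc (d (p v))"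
    using tree_depth_exists[OF rt] by blast
  interpret rooted V r p d
    using d g rt by unfold_locales (auto simp: simple_graph_def rooted_tree_def)
  have inj: "inj_on \<iota> V" and img: "\<iota> ` V = {1..card V}"
    using \<iota> by (auto simp: id_assignment_def bij_betw_def)
  have edge: "u \<in> V \<and> v \<in> V \<and> u \<noteq> v \<and> E v u" if "E u v" for u v
    using g that unfolding simple_graph_def by blast
  obtain col where col: "\<And>v. v \<in> V \<Longrightarrow> col v \<le> k"
    "\<And>u v. v \<in> V \<Longrightarrow> u \<in> strv V E r p v - {v} \<Longrightarrow> col u \<noteq> col v"
    using colouring_exists[OF width] by blast
  let ?s = "\<lambda>v. strv V E r p v - {v}"
  \<comment> \<open>The greedy colouring separates \<open>v\<close> only from the rest of str(v).
    Two members of str(v) are comparable, and \<open>strv_mono\<close> puts the upper one into the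
    str of the lower, so they too differ in colour and each slot has one occupant.\<close>
  have uniq: "u = u'" if v: "v \<in> V" and u: "u \<in> ?s v" "u' \<in> ?s v" "col u = col u'" for v u u'
  proof (rule ccontr)
    assume ne: "u \<noteq> u'"
    have *: "below u v" "below u' v" "u \<in> V" "u' \<in> V" using strv_strict[OF v] u by blast+
    from anc_linear[OF *(1,2)] show False
    proof
      assume "below u u'"
      from col(2)[OF *(4) strv_mono[OF u(1) *(2) this ne]] show False using u by simp
    next
      assume "below u' u"
      from col(2)[OF *(3) strv_mono[OF u(2) *(1) this]] show False using u ne by auto
    qed
  qed
  define a where "a v c = (if v \<in> V \<and> (\<exists>u\<in>?s v. col u = c) then \<iota> (SOME u. u \<in> ?s v \<and> col u = c) else 0)"
    for v c
  have a_val: "a v (col u) = \<iota> u" if "v \<in> V" "u \<in> ?s v" for u v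
  proof -
    have "(SOME u'. u' \<in> ?s v \<and> col u' = col u) = u"
      by (rule some_equality) (use that uniq[OF that(1)] in auto)
    then show ?thesis using that by (auto simp: a_def)
  qed
  have a_nz: "\<exists>u\<in>?s v. col u = c" if "a v c \<noteq> 0" for v c
    using that by (auto simp: a_def split: if_splits)
  have a_le: "a v c \<le> card V" for v c
  proof (cases "v \<in> V \<and> (\<exists>u\<in>?s v. col u = c)")
    case True
    then obtain u where u: "v \<in> V" "u \<in> ?s v" "col u = c" by blast
    then have "\<iota> u \<in> \<iota> ` V" using strv_strict by blast
    then show ?thesis using a_val[OF u(1,2)] u(3) img by simp
  qed (auto simp: a_def)
  have "etree k V E \<iota> r p d col a"
  proof unfold_locales
    show "inj_on \<iota> V" by (rule inj)
  next
    fix v assume v: "v \<in> V"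
    show "\<iota> v \<noteq> 0" using img v by fastforce
    show "col v \<le> k" by (rule col(1)[OF v])
    show "a v (col v) = 0" using a_nz[of v "col v"] col(2)[OF v] by blast
    fix c assume ne: "v \<noteq> r" and "c \<le> k" and nz: "a v c \<noteq> 0"
    then obtain u where u: "u \<in> ?s v" "col u = c" using a_nz by blast
    have av: "a v c = \<iota> u" using a_val[OF v u(1)] u(2) by simp
    note uv = strv_strict[OF v u(1)]
    show "a v c = \<iota> (p v) \<and> c = col (p v) \<or> a v c = a (p v) c"
    proof (cases "u = p v")
      case False
      have "below u (p v)" using uv ne by (auto elim: anc.cases)
      moreover have "below (p v) v" using ne by (auto intro: anc.intros)
      ultimately have "u \<in> ?s (p v)" using strv_mono[OF u(1)] False by blast
      then show ?thesis using a_val[OF par_in[OF v ne]] av u by auto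
    qed (use av u in simp)
  next
    fix u v assume e: "E u v"
    then show "u \<in> V \<and> v \<in> V \<and> E v u" using edge by blast
    have "anc V r p u v \<or> anc V r p v u" using el e edge[OF e] by (auto simp: elimination_tree_def)
    then show "(\<exists>c\<le>k. a v c = \<iota> u) \<or> (\<exists>c\<le>k. a u c = \<iota> v)"
    proof
      assume "anc V r p u v"
      then have "u \<in> ?s v" using e edge[OF e] by (auto simp: strv_def subtree_def intro: anc.intros)
      then show ?thesis using a_val[of v u] edge[OF e] col(1) by blast
    next
      assume "anc V r p v u"
      then have "v \<in> ?s u" using e edge[OF e] by (auto simp: strv_def subtree_def intro: anc.intros)
      then show ?thesis using a_val[of u v] edge[OF e] col(1) by blast
    qed
  next
    fix c
    show "a r c = 0"
    proof (rule ccontr)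
      assume "a r c \<noteq> 0"
      then obtain u where "u \<in> ?s r" using a_nz by blast
      then show False using strv_strict[OF root_in] depth_root by auto
    qed
  qed
  then show ?thesis using a_le by blast
qed

text \<open>\<open>D\<close> is the length of a shortest walk to \<open>o'\<close>; the second
  vertex of such a walk is exactly one closer.\<close>

lemma distance_exists:
  assumes con: "connected_graph V E" and fin: "finite V" and o': "o' \<in> V"
  shows "\<exists>D. (\<forall>v\<in>V. (D v = 0 \<longrightarrow> v = o') \<and> (D v \<noteq> 0 \<longrightarrow> (\<exists>w\<in>V. E v w \<and> Suc (D w) = D v)) \<and> D v < card V)"
proof -
  let ?e = "\<lambda>u v. u \<in> V \<and> v \<in> V \<and> E u v"
  define D where "D v = (LEAST n. (?e ^^ n) v o')" for v
  have ex: "(?e ^^ D v) v o'" if "v \<in> V" for v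
  proof -
    have "\<exists>n. (?e ^^ n) v o'"
      using con that o' unfolding connected_graph_def reach_def by (auto simp: rtranclp_power)
    then show ?thesis unfolding D_def by (rule LeastI_ex)
  qed
  have step: "\<exists>w\<in>V. E v w \<and> Suc (D w) = D v" if v: "v \<in> V" "D v \<noteq> 0" for v
  proof -
    obtain n where n: "D v = Suc n" using v(2) not0_implies_Suc by blast
    then have "(?e ^^ Suc n) v o'" using ex[OF v(1)] by simp
    then obtain w where w: "?e v w" "(?e ^^ n) w o'" by (rule relpowp_Suc_E2)
    have "D w \<le> n" unfolding D_def by (rule Least_le) (rule w(2))
    moreover have "D v \<le> Suc (D w)" unfolding D_def[of v]
      by (rule Least_le) (rule relpowp_Suc_I2[of ?e v w "D w" o'], rule w(1), rule ex, use w(1) in blast)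
    ultimately show ?thesis using w(1) n by (intro bexI[of _ w]) auto
  qed
  have "D v = 0 \<longrightarrow> v = o'" if "v \<in> V" for v using ex[OF that] by auto
  moreover have "D v < card V" if "v \<in> V" for v
    by (rule rank_less_card[OF fin _ that]) (use step in blast)
  ultimately show ?thesis using step by blast
qed

section \<open>Labels of the prover\<close>

text \<open>Five header fields plus the \<open>k + 1\<close> slots give
  \<open>k + 6\<close>.\<close>

definition bounded_rec :: "nat \<Rightarrow> nat \<Rightarrow> nat list \<Rightarrow> bool" where
  "bounded_rec B k R \<longleftrightarrow> length R = k + 6 \<and> (\<forall>x\<in>set R. x < B)"

definition bounded_label :: "nat \<Rightarrow> nat \<Rightarrow> label \<Rightarrow> bool" where
  "bounded_label B k l \<longleftrightarrow> ldist l < B \<and> lroot l < B \<and> bounded_rec B k (lrec l) \<and> length (litems l) \<le> k \<and>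
     (\<forall>(m, x, Q)\<in>set (litems l). m < B \<and> x < B \<and> bounded_rec B k Q)"

lemma accepted_labels_exist:
  assumes g: "simple_graph V E" and con: "connected_graph V E" and \<iota>: "id_assignment V \<iota>"
    and et: "etree k V E \<iota> r p d col a" and a_le: "\<And>v c. a v c \<le> card V"
    and S: "path_system V E S" "congestion_le V S (int k)" "witnesses V E S r p"
    and run: "etree.run k V E \<iota> r p col a f (\<lambda>_. {}) \<rho>" and acc: "acc (\<rho> (\<iota> r))"
    and f_less: "\<And>c S m X g. f c S m X g < N"
  shows "\<exists>\<Lambda>. \<forall>v\<in>V. accepts k f acc (\<iota> v) (\<Lambda> v) ((\<lambda>w. (\<iota> w, \<Lambda> w)) ` {w. E v w}) \<and>
    bounded_label (card V + k + N + 2) k (\<Lambda> v)"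
proof -
  interpret etree k V E \<iota> r p d col a by (rule et)
  have img: "\<iota> ` V = {1..card V}" using \<iota> by (auto simp: id_assignment_def bij_betw_def)
  have id_le: "\<iota> v \<le> card V" if "v \<in> V" for v using img that by fastforce
  have edge: "u \<in> V \<and> v \<in> V \<and> u \<noteq> v \<and> E v u" if "E u v" for u v
    using g that unfolding simple_graph_def by blast
  have "card V \<ge> 1" using fin root_in by (metis One_nat_def Suc_leI card_gt_0_iff empty_iff)
  then have "1 \<in> \<iota> ` V" using img by auto
  then obtain o' where o': "o' \<in> V" "\<iota> o' = 1" by auto
  obtain D where dist: "\<forall>v\<in>V. (D v = 0 \<longrightarrow> v = o') \<and>
      (D v \<noteq> 0 \<longrightarrow> (\<exists>w\<in>V. E v w \<and> Suc (D w) = D v)) \<and> D v < card V"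
    using distance_exists[OF con fin o'(1)] by (rule exE)
  then have D: "\<And>v. v \<in> V \<Longrightarrow> D v = 0 \<Longrightarrow> v = o'"
    "\<And>v. v \<in> V \<Longrightarrow> D v \<noteq> 0 \<Longrightarrow> \<exists>w\<in>V. E v w \<and> Suc (D w) = D v" "\<And>v. v \<in> V \<Longrightarrow> D v < card V"
    by simp_all
  define T where "T = {s \<in> V. s \<noteq> r \<and> \<not> E s (p s)}"
  have "\<exists>P\<in>S. hd P = s \<and> last P = p s" if "s \<in> T" for s
    using S(3) that unfolding witnesses_def T_def by blast
  then obtain P where P: "\<And>s. s \<in> T \<Longrightarrow> P s \<in> S" "\<And>s. s \<in> T \<Longrightarrow> hd (P s) = s"
    "\<And>s. s \<in> T \<Longrightarrow> last (P s) = p s" by metis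
  have Pp: "P s \<noteq> []" "distinct (P s)" "set (P s) \<subseteq> V"
    "\<And>i. Suc i < length (P s) \<Longrightarrow> E (P s ! i) (P s ! Suc i)" if "s \<in> T" for s
    using P(1)[OF that] S(1) unfolding path_system_def oriented_path_def by blast+
  have Plen: "length (P s) \<le> card V" if "s \<in> T" for s
    using Pp(2,3)[OF that] fin by (metis card_mono distinct_card)
  define rc where "rc v = [\<iota> v, if v = r then 0 else \<iota> (p v), d v, col v, \<rho> (\<iota> v)] @ map (a v) [0..<Suc k]" for v
  have rc: "rid (rc v) = \<iota> v" "rpar (rc v) = (if v = r then 0 else \<iota> (p v))" "rdep (rc v) = d v"
    "rcol (rc v) = col v" "rstate (rc v) = \<rho> (\<iota> v)" "c \<le> k \<Longrightarrow> ranc (rc v) c = a v c" for v c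
    by (simp_all add: rc_def rid_def rpar_def rdep_def rcol_def rstate_def ranc_def nth_append del: upt_Suc)
  have rpar_iff: "rpar (rc s) = \<iota> v \<longleftrightarrow> s \<in> children v" if "s \<in> V" "v \<in> V" for s v
    using that key_nz[of v] key_eq[of "p s" v] par_in[of s] by (auto simp: rc children_def)
  \<comment> \<open>As in the definition of congestion, the last vertex of a path stores no item for
    it.\<close>
  define I where "I u = {(m, \<iota> (P s ! Suc m), rc s) | s m. s \<in> T \<and> Suc m < length (P s) \<and> P s ! m = u}" for u
  have TV: "s \<in> V" "s \<noteq> r" if "s \<in> T" for s using that by (auto simp: T_def)
  have I: "finite (I u) \<and> card (I u) \<le> k" if u: "u \<in> V" for u
  proof -
    let ?X = "{Q \<in> S. u \<in> set (butlast Q)}"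
    \<comment> \<open>A simple path meets \<open>u\<close> at one index, so the item is determined
      by the path, and \<open>u\<close> stores no more items than the paths counted in its
      congestion.\<close>
    let ?h = "\<lambda>Q. let m = (THE m. m < length Q \<and> Q ! m = u) in (m, \<iota> (Q ! Suc m), rc (hd Q))"
    \<comment> \<open>\<open>card\<close> of an infinite set is 0, so the congestion bound says
      something only once the set is finite; a finite graph has finitely many simple paths.\<close>
    have "S \<subseteq> {xs. set xs \<subseteq> V \<and> length xs \<le> card V}"
    proof
      fix xs assume "xs \<in> S"
      then have "distinct xs" "set xs \<subseteq> V" using S(1) by (auto simp: path_system_def oriented_path_def)
      then show "xs \<in> {xs. set xs \<subseteq> V \<and> length xs \<le> card V}"
        using fin by (metis (mono_tags, lifting) card_mono distinct_card mem_Collect_eq)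
    qed
    then have finX: "finite ?X"
      using finite_lists_length_le[OF fin] by (auto intro: finite_subset)
    have sub: "I u \<subseteq> ?h ` ?X"
    proof
      fix z assume "z \<in> I u"
      then obtain s m where z: "z = (m, \<iota> (P s ! Suc m), rc s)" "s \<in> T" "Suc m < length (P s)" "P s ! m = u"
        unfolding I_def by blast
      have "(THE m. m < length (P s) \<and> P s ! m = u) = m"
        using z Pp(2)[OF z(2)] by (intro the_equality) (auto simp: nth_eq_iff_index_eq)
      then have "z = ?h (P s)" using z P(2) by simp
      moreover have "u \<in> set (butlast (P s))"
        using z(3,4) by (auto simp: in_set_conv_nth nth_butlast intro!: exI[of _ m])
      ultimately show "z \<in> ?h ` ?X" using P(1)[OF z(2)] by blast
    qed
    then have "card (I u) \<le> card ?X"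
      using finX by (meson card_image_le card_mono finite_imageI le_trans)
    also have "\<dots> \<le> k" using S(2) u by (auto simp: congestion_le_def congestion_at_def)
    finally show ?thesis using finite_subset[OF sub] finX by blast
  qed
  then have "\<exists>xs. set xs = I u \<and> length xs \<le> k" if "u \<in> V" for u
    using that by (metis finite_distinct_list distinct_card)
  then obtain L where L: "\<And>u. u \<in> V \<Longrightarrow> set (L u) = I u" "\<And>u. u \<in> V \<Longrightarrow> length (L u) \<le> k" by metis
  define \<Lambda> where "\<Lambda> v = Label (D v) (\<iota> r) (rc v) (L v)" for v
  let ?Nb = "\<lambda>v. (\<lambda>w. (\<iota> w, \<Lambda> w)) ` {w. E v w}"
  have Nb_ex: "(\<exists>(j, l)\<in>?Nb v. Q j l) \<longleftrightarrow> (\<exists>w. E v w \<and> Q (\<iota> w) (\<Lambda> w))" for v Q by auto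
  have Nb_all: "(\<forall>(j, l)\<in>?Nb v. Q j l) \<longleftrightarrow> (\<forall>w. E v w \<longrightarrow> Q (\<iota> w) (\<Lambda> w))" for v Q by auto
  have \<Lambda>: "ldist (\<Lambda> v) = D v" "lroot (\<Lambda> v) = \<iota> r" "lrec (\<Lambda> v) = rc v" "litems (\<Lambda> v) = L v" for v
    by (simp_all add: \<Lambda>_def)
  have child: "child_recs (\<iota> v) (?Nb v) = rc ` children v" if v: "v \<in> V" for v
  proof (intro equalityI subsetI)
    fix R assume "R \<in> child_recs (\<iota> v) (?Nb v)"
    then obtain w where w: "rpar R = \<iota> v" "E v w" "R = rc w \<or> (\<exists>m. (m, \<iota> v, R) \<in> set (L w))"
      unfolding child_recs_def Nb_ex by (auto simp: \<Lambda>)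
    have "\<exists>s\<in>V. R = rc s"
      using w(3) edge[OF w(2)] L(1)[of w] TV unfolding I_def by auto
    then show "R \<in> rc ` children v" using rpar_iff v w(1) by auto
  next
    fix R assume "R \<in> rc ` children v"
    then obtain s where s: "R = rc s" "s \<in> V" "s \<noteq> r" "p s = v" by (auto simp: children_def)
    then have par: "rpar R = \<iota> v" by (simp add: rc)
    have "\<exists>w. E v w \<and> (R = rc w \<or> (\<exists>m. (m, \<iota> v, R) \<in> set (L w)))"
    proof (cases "E s v")
      case True
      then show ?thesis using edge s by blast
    next
      case False
      then have sT: "s \<in> T" using s by (auto simp: T_def)
      have "s \<noteq> v" using s depth_par[OF s(2,3)] by auto
      then have "hd (P s) \<noteq> last (P s)" using P[OF sT] s by simp
      then have len: "2 \<le> length (P s)" using Pp(1)[OF sT]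
        by (cases "P s" rule: remdups_adj.cases) auto
      \<comment> \<open>Index of the last vertex but one, a neighbour of \<open>v\<close> whose item
        names \<open>v\<close>.\<close>
      define m where "m = length (P s) - 2"
      have m: "Suc m < length (P s)" "P s ! Suc m = v"
        using len P(3)[OF sT] s Pp(1)[OF sT] by (auto simp: m_def last_conv_nth Suc_diff_Suc numeral_2_eq_2)
      then have "E (P s ! m) v" using Pp(4)[OF sT m(1)] by simp
      moreover have "(m, \<iota> v, R) \<in> I (P s ! m)" using sT m s unfolding I_def by blast
      ultimately show ?thesis using edge L(1) by blast
    qed
    then show "R \<in> child_recs (\<iota> v) (?Nb v)" unfolding child_recs_def Nb_ex using par by (auto simp: \<Lambda>)
  qed
  \<comment> \<open>One bound for all numbers: identifiers and slots are at most
    \<open>card V\<close>, depths and indices below it, colours at most \<open>k\<close>, states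
    below \<open>N\<close>.\<close>
  have brec: "bounded_rec (card V + k + N + 2) k (rc v)" if v: "v \<in> V" for v
  proof -
    have "\<rho> (\<iota> v) < N" using run v f_less unfolding run_def by simp
    moreover have "d v < card V" by (rule depth_less_card[OF v])
    moreover have "a v c < card V + k + N + 2" for c using a_le[of v c] by simp
    moreover have "(if v = r then 0 else \<iota> (p v)) \<le> card V" using par_in[OF v] id_le by auto
    ultimately show ?thesis using id_le[OF v] col_le[OF v]
      unfolding bounded_rec_def rc_def by (auto simp del: upt_Suc)
  qed
  have "accepts k f acc (\<iota> v) (\<Lambda> v) (?Nb v)" if v: "v \<in> V" for v
    unfolding accepts_def Let_def Nb_ex Nb_all child[OF v] \<Lambda>
  proof (intro conjI)
    show "rid (rc v) = \<iota> v" by (rule rc)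
    show "if D v = 0 then \<iota> v = 1 else \<exists>w. E v w \<and> Suc (D w) = D v"
      using D(1,2)[OF v] o' by auto
    show "\<forall>w. E v w \<longrightarrow> \<iota> r = \<iota> r" by simp
    show "(rpar (rc v) = 0) = (\<iota> v = \<iota> r)"
      using key_eq[OF v root_in] key_nz[of "p v"] par_in[OF v] by (auto simp: rc)
    show "rcol (rc v) \<le> k" using col_le[OF v] by (simp add: rc)
    show "ranc (rc v) (rcol (rc v)) = 0" using col_le[OF v] a_col[OF v] by (simp add: rc)
    show "\<iota> v = \<iota> r \<longrightarrow> rdep (rc v) = 0 \<and> (\<forall>c\<le>k. ranc (rc v) c = 0) \<and> acc (rstate (rc v))"
      using key_eq[OF v root_in] a_root depth_root acc by (auto simp: rc)
    show "rpar (rc v) \<noteq> 0 \<longrightarrow> (\<exists>w. E v w \<and> \<iota> w = rpar (rc v)) \<or> (\<exists>x. (0, x, rc v) \<in> set (L v))"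
    proof
      assume "rpar (rc v) \<noteq> 0"
      then have vr: "v \<noteq> r" by (auto simp: rc)
      show "(\<exists>w. E v w \<and> \<iota> w = rpar (rc v)) \<or> (\<exists>x. (0, x, rc v) \<in> set (L v))"
      proof (cases "E v (p v)")
        case True
        then show ?thesis using vr by (auto simp: rc)
      next
        case False
        then have vT: "v \<in> T" using v vr by (auto simp: T_def)
        have "v \<noteq> p v" using depth_par[OF v vr] by auto
        then have "hd (P v) \<noteq> last (P v)" using P[OF vT] by simp
        then have "Suc 0 < length (P v)" using Pp(1)[OF vT]
          by (cases "P v" rule: remdups_adj.cases) auto
        moreover have "P v ! 0 = v" using P(2)[OF vT] Pp(1)[OF vT] by (simp add: hd_conv_nth)
        ultimately have "(0, \<iota> (P v ! Suc 0), rc v) \<in> I v" using vT unfolding I_def by blast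
        then show ?thesis using L(1)[OF v] by blast
      qed
    qed
    show "length (L v) \<le> k" by (rule L(2)[OF v])
    show "\<forall>m x Q m' x' Q'. (m, x, Q) \<in> set (L v) \<longrightarrow> (m', x', Q') \<in> set (L v) \<longrightarrow> rid Q = rid Q' \<longrightarrow> m = m'"
    proof (intro allI impI)
      fix m x Q m' x' Q' assume "(m, x, Q) \<in> set (L v)" "(m', x', Q') \<in> set (L v)" and eq: "rid Q = rid Q'"
      then obtain s s' where s: "s \<in> T" "Suc m < length (P s)" "P s ! m = v" "Q = rc s"
        and s': "s' \<in> T" "Suc m' < length (P s')" "P s' ! m' = v" "Q' = rc s'"
        unfolding L(1)[OF v] I_def by blast
      have "s = s'" using eq s s' key_eq[OF TV(1)[OF s(1)] TV(1)[OF s'(1)]] by (simp add: rc)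
      then show "m = m'" using s s' nth_eq_iff_index_eq[OF Pp(2)[OF s(1)], of m m'] by simp
    qed
    show "\<forall>m x Q. (m, x, Q) \<in> set (L v) \<longrightarrow> rpar Q \<noteq> \<iota> v \<and>
        (\<exists>w. E v w \<and> \<iota> w = x \<and> (x = rpar Q \<or> (\<exists>y. (Suc m, y, Q) \<in> set (L w)))) \<and>
        (if m = 0 then Q = rc v else \<exists>w. E v w \<and> (m - 1, \<iota> v, Q) \<in> set (L w))"
    proof (intro allI impI)
      fix m x Q assume "(m, x, Q) \<in> set (L v)"
      then obtain s where s: "s \<in> T" "Suc m < length (P s)" "P s ! m = v" "Q = rc s" "x = \<iota> (P s ! Suc m)"
        unfolding L(1)[OF v] I_def by blast
      note Ps = Pp[OF s(1)]
      have parQ: "rpar Q = \<iota> (p s)" using TV[OF s(1)] s by (simp add: rc)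
      have psV: "p s \<in> V" using TV[OF s(1)] par_in by blast
      have last: "P s ! (length (P s) - 1) = p s" using P(3)[OF s(1)] Ps(1) by (simp add: last_conv_nth)
      have "p s \<noteq> v"
      proof
        assume "p s = v"
        then have "P s ! (length (P s) - 1) = P s ! m" using last s by simp
        then show False using Ps(2) s(2) by (simp add: nth_eq_iff_index_eq)
      qed
      then have 1: "rpar Q \<noteq> \<iota> v" using parQ key_eq psV v by simp
      have e: "E v (P s ! Suc m)" using Ps(4)[OF s(2)] s(3) by simp
      have 2: "x = rpar Q \<or> (\<exists>y. (Suc m, y, Q) \<in> set (L (P s ! Suc m)))"
      proof (cases "Suc (Suc m) < length (P s)")
        case True
        then have "(Suc m, \<iota> (P s ! Suc (Suc m)), Q) \<in> I (P s ! Suc m)" using s unfolding I_def by blast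
        then show ?thesis using L(1) edge[OF e] by blast
      next
        case False
        then have "Suc m = length (P s) - 1" using s(2) by linarith
        then show ?thesis using last s(5) parQ by simp
      qed
      have 3: "if m = 0 then Q = rc v else \<exists>w. E v w \<and> (m - 1, \<iota> v, Q) \<in> set (L w)"
      proof (cases m)
        case 0
        then have "s = v" using s P(2)[OF s(1)] Ps(1) by (simp add: hd_conv_nth)
        then show ?thesis using 0 s by simp
      next
        case (Suc n)
        then have e': "E (P s ! n) v" using Ps(4)[of n] s by simp
        have "(n, \<iota> v, Q) \<in> I (P s ! n)" using s Suc unfolding I_def
          by (intro CollectI exI[of _ s] exI[of _ n]) auto
        then show ?thesis using Suc e' edge[OF e'] L(1) by auto
      qed
      show "rpar Q \<noteq> \<iota> v \<and> (\<exists>w. E v w \<and> \<iota> w = x \<and> (x = rpar Q \<or> (\<exists>y. (Suc m, y, Q) \<in> set (L w)))) \<and>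
        (if m = 0 then Q = rc v else \<exists>w. E v w \<and> (m - 1, \<iota> v, Q) \<in> set (L w))"
        by (intro conjI exI[of _ "P s ! Suc m"], rule 1, rule e, rule s(5)[symmetric], rule 2, rule 3)
    qed
    show "\<forall>w. E v w \<longrightarrow> (\<exists>c\<le>k. ranc (rc v) c = \<iota> w) \<or> (\<exists>c\<le>k. ranc (rc w) c = \<iota> v)"
    proof (intro allI impI)
      fix w assume "E v w"
      from edge_a[OF this] show "(\<exists>c\<le>k. ranc (rc v) c = \<iota> w) \<or> (\<exists>c\<le>k. ranc (rc w) c = \<iota> v)"
        using rc(6) by metis
    qed
    show "\<forall>Q\<in>rc ` children v. rdep Q = Suc (rdep (rc v)) \<and>
        (\<forall>c\<le>k. ranc Q c \<noteq> 0 \<longrightarrow> ranc Q c = \<iota> v \<and> c = rcol (rc v) \<or> ranc Q c = ranc (rc v) c)"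
    proof
      fix Q assume "Q \<in> rc ` children v"
      then obtain x where x: "Q = rc x" "x \<in> V" "x \<noteq> r" "p x = v" by (auto simp: children_def)
      show "rdep Q = Suc (rdep (rc v)) \<and>
        (\<forall>c\<le>k. ranc Q c \<noteq> 0 \<longrightarrow> ranc Q c = \<iota> v \<and> c = rcol (rc v) \<or> ranc Q c = ranc (rc v) c)"
        using x depth_par[OF x(2,3)] a_step[OF x(2,3)] by (auto simp: rc)
    qed
    have ids: "rid ` rc ` children v = \<iota> ` children v" by (simp add: image_image rc)
    have cols: "{c. c \<le> k \<and> (\<exists>w. E v w \<and> ranc (rc v) c = \<iota> w)} = up_cols v"
      unfolding up_cols_def by (auto simp: rc)
    show "\<exists>g. (\<forall>Q\<in>rc ` children v. g (rid Q) = rstate Q) \<and> rstate (rc v) =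
        f (rcol (rc v)) {c. c \<le> k \<and> (\<exists>w. E v w \<and> ranc (rc v) c = \<iota> w)} {} (rid ` rc ` children v) g"
      unfolding ids cols using run v by (intro exI[of _ \<rho>]) (auto simp: rc run_def)
  qed
  moreover have "bounded_label (card V + k + N + 2) k (\<Lambda> v)" if v: "v \<in> V" for v
  proof -
    have "m < card V \<and> x \<le> card V \<and> bounded_rec (card V + k + N + 2) k Q"
      if mem: "(m, x, Q) \<in> set (L v)" for m x Q
    proof -
      obtain s where s: "s \<in> T" "Suc m < length (P s)" "Q = rc s" "x = \<iota> (P s ! Suc m)"
        using mem unfolding L(1)[OF v] I_def by blast
      have "P s ! Suc m \<in> V" using s Pp(3)[OF s(1)] nth_mem by blast
      then show ?thesis using s Plen[OF s(1)] id_le brec[OF TV(1)[OF s(1)]] by auto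
    qed
    then show ?thesis unfolding bounded_label_def
      using D(3)[OF v] id_le[OF root_in] brec[OF v] L(2)[OF v] by (fastforce simp: \<Lambda>)
  qed
  ultimately show ?thesis by blast
qed

section \<open>Binary encoding of labels\<close>

fun bits :: "nat \<Rightarrow> bool list" where
  "bits n = (if n = 0 then [] else odd n # bits (n div 2))"

declare bits.simps [simp del]

fun unbits :: "bool list \<Rightarrow> nat" where
  "unbits [] = 0"
| "unbits (b # bs) = of_bool b + 2 * unbits bs"

lemma unbits_bits: "unbits (bits n) = n"
proof (induction n rule: bits.induct)
  case (1 n)
  then show ?case by (cases "n = 0") (simp_all add: bits.simps odd_two_times_div_two_succ)
qed

lemma length_bits_le: "n < 2 ^ m \<Longrightarrow> length (bits n) \<le> m"
proof (induction m arbitrary: n)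
  case (Suc m)
  then have "n div 2 < 2 ^ m" by auto
  with Suc.IH show ?case by (subst bits.simps) simp
qed (simp add: bits.simps)

definition item_code :: "nat \<times> nat \<times> nat list \<Rightarrow> nat" where
  "item_code t = (case t of (m, x, Q) \<Rightarrow> prod_encode (m, prod_encode (x, list_encode Q)))"

definition label_code :: "label \<Rightarrow> nat" where
  "label_code l = prod_encode (ldist l, prod_encode (lroot l,
     prod_encode (list_encode (lrec l), list_encode (map item_code (litems l)))))"

lemma inj_item_code: "inj item_code"
  by (auto simp: inj_def item_code_def list_encode_eq)

lemma inj_label_code: "inj label_code"
proof (rule injI)
  fix l l' assume "label_code l = label_code l'"
  then have "ldist l = ldist l'" "lroot l = lroot l'" "lrec l = lrec l'"
    "map item_code (litems l) = map item_code (litems l')" by (simp_all add: label_code_def list_encode_eq)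
  then show "l = l'" by (intro label.expand) (simp add: inj_map_eq_map[OF inj_item_code])
qed

definition encode :: "label \<Rightarrow> bool list" where "encode l = bits (label_code l)"
text \<open>A string outside the range of \<open>encode\<close> is read as some label too. Soundness
  concerns arbitrary labels, so such strings give an adversary nothing new.\<close>

definition decode :: "bool list \<Rightarrow> label" where "decode = inv encode"

lemma decode_encode: "decode (encode l) = l"
proof -
  have "inj encode"
    by (rule injI) (metis encode_def unbits_bits inj_label_code injD)
  then show ?thesis by (simp add: decode_def)
qed

section \<open>Polynomial bounds on codes\<close>

text \<open>The pairing function is quadratic: with \<open>s = x + y\<close> the code is below
  \<open>(s + 1)^2\<close>, and \<open>s + 1 \<le> 2 * B ^ m \<le> B ^ (m + 1)\<close>.\<close>

lemma prod_encode_less: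
  fixes B :: nat
  assumes "2 \<le> B" "x < B ^ m" "y < B ^ m"
  shows "prod_encode (x, y) < B ^ (2 * m + 2)"
proof -
  define s where "s = x + y"
  have "triangle s \<le> s * Suc s" by (simp add: triangle_def)
  then have "prod_encode (x, y) \<le> s * Suc s + s" by (simp add: prod_encode_def s_def)
  also have "\<dots> < Suc s * Suc s" by simp
  also have "Suc s \<le> 2 * B ^ m" using assms by (simp add: s_def)
  then have le: "Suc s \<le> B ^ Suc m" using mult_le_mono1[OF assms(1), of "B ^ m"] by (metis le_trans power_Suc)
  have "Suc s * Suc s \<le> B ^ Suc m * B ^ Suc m" by (rule mult_le_mono[OF le le])
  also have "\<dots> = B ^ (2 * m + 2)" by (simp add: power_add[symmetric] mult_2)
  finally show ?thesis .
qed

text \<open>Exponents for \<open>list_encode\<close>: each element costs \<open>2 * e + 2\<close>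
  for the pair and one more for the successor. Values stay at least \<open>m\<close>, so the
  elements obey the same bound as the code of the tail.\<close>

fun list_exp :: "nat \<Rightarrow> nat \<Rightarrow> nat" where
  "list_exp m 0 = Suc m"
| "list_exp m (Suc n) = 2 * list_exp m n + 3"

lemma list_exp_ge: "m \<le> list_exp m n"
  by (induction n) auto

lemma less_power_mono: "x < B ^ m \<Longrightarrow> m \<le> n \<Longrightarrow> (2 :: nat) \<le> B \<Longrightarrow> x < B ^ n"
  by (erule order_less_le_trans) (simp add: power_increasing)

lemma list_encode_less:
  fixes B :: nat
  assumes B: "2 \<le> B"
  shows "length xs \<le> n \<Longrightarrow> \<forall>x\<in>set xs. x < B ^ m \<Longrightarrow> list_encode xs < B ^ list_exp m n"
proof (induction n arbitrary: xs)
  case (Suc n)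
  show ?case
  proof (cases xs)
    case (Cons x ys)
    have "list_encode ys < B ^ list_exp m n" using Suc Cons by simp
    moreover have "x < B ^ list_exp m n"
      using Suc.prems Cons less_power_mono[OF _ list_exp_ge B] by simp
    ultimately have "prod_encode (x, list_encode ys) < B ^ (2 * list_exp m n + 2)"
      using prod_encode_less[OF B] by simp
    then have "list_encode xs \<le> B ^ (2 * list_exp m n + 2)" using Cons by simp
    also have "\<dots> < B ^ (2 * list_exp m n + 3)" using B by (intro power_strict_increasing) auto
    finally show ?thesis by simp
  qed (use B in simp)
qed (use B in simp)

text \<open>The nesting of pairs and lists depends only on \<open>k\<close>, hence so does the
  exponent; the code is polynomial in \<open>B\<close> and its bit length logarithmic.\<close>

lemma label_code_polynomial:
  "\<exists>q. \<forall>B l. 2 \<le> B \<longrightarrow> bounded_label B k l \<longrightarrow> label_code l < B ^ q"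
proof -
  define e1 where "e1 = list_exp 1 (k + 6)"
  \<comment> \<open>Two nested pairs per item, a list of at most \<open>k\<close> items, then three
    nested pairs for the label.\<close>
  define e2 where "e2 = 2 * (2 * e1 + 2) + 2"
  define e3 where "e3 = list_exp e2 k"
  define e4 where "e4 = 2 * (2 * (2 * e3 + 2) + 2) + 2"
  have "1 \<le> e1" unfolding e1_def by (rule list_exp_ge)
  have "e2 \<le> e3" unfolding e3_def by (rule list_exp_ge)
  then have "e1 \<le> e3" by (simp add: e2_def)
  have "label_code l < B ^ e4" if B: "2 \<le> B" and l: "bounded_label B k l" for B l
  proof -
    have R: "list_encode R < B ^ e1" if "bounded_rec B k R" for R
      unfolding e1_def using that by (intro list_encode_less[OF B]) (auto simp: bounded_rec_def)
    have small: "x < B ^ e" if "x < B" "1 \<le> e" for x e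
      using less_power_mono[of x B 1 e] that B by simp
    have "item_code t < B ^ e2" if "t \<in> set (litems l)" for t
    proof -
      obtain m x Q where t: "t = (m, x, Q)" by (cases t)
      then have b: "m < B" "x < B" "bounded_rec B k Q" using l that by (auto simp: bounded_label_def)
      have inner: "prod_encode (x, list_encode Q) < B ^ (2 * e1 + 2)"
        by (rule prod_encode_less[OF B small[OF b(2) \<open>1 \<le> e1\<close>] R[OF b(3)]])
      have "prod_encode (m, prod_encode (x, list_encode Q)) < B ^ e2"
        unfolding e2_def by (rule prod_encode_less[OF B small[OF b(1)] inner]) simp
      then show ?thesis by (simp add: t item_code_def)
    qed
    then have "list_encode (map item_code (litems l)) < B ^ e3"
      unfolding e3_def using l by (intro list_encode_less[OF B]) (auto simp: bounded_label_def)
    moreover have "list_encode (lrec l) < B ^ e3"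
      using less_power_mono[OF R \<open>e1 \<le> e3\<close> B] l by (simp add: bounded_label_def)
    moreover have "lroot l < B ^ (2 * e3 + 2)" "ldist l < B ^ (2 * (2 * e3 + 2) + 2)"
      using small[of "lroot l" "2 * e3 + 2"] small[of "ldist l" "2 * (2 * e3 + 2) + 2"] l
      by (simp_all add: bounded_label_def)
    ultimately show ?thesis unfolding label_code_def e4_def by (intro prod_encode_less[OF B])
  qed
  then show ?thesis by blast
qed

lemma encode_length:
  "\<exists>c::real. \<forall>n l. 1 \<le> n \<longrightarrow> bounded_label (n + k + N + 2) k l \<longrightarrow>
     real (length (encode l)) \<le> c * log 2 (real n) + c"
proof -
  obtain q where q: "\<And>B l. 2 \<le> B \<Longrightarrow> bounded_label B k l \<Longrightarrow> label_code l < B ^ q"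
    using label_code_polynomial by blast
  \<comment> \<open>\<open>n + (k + N + 2) \<le> n * K\<close> for \<open>n \<ge> 1\<close>, which
    splits the logarithm into that of \<open>n\<close> and a constant.\<close>
  define K where "K = k + N + 3"
  \<comment> \<open>The summand 1 absorbs the rounding in \<open>t\<close>, and makes
    \<open>c \<ge> q\<close> as the coefficient of the logarithm.\<close>
  define c where "c = real q * (log 2 (real K) + 1)"
  have Kpos: "0 < K" by (simp add: K_def)
  have logK: "0 \<le> log 2 (real K)" by (simp add: K_def)
  have "real (length (encode l)) \<le> c * log 2 (real n) + c"
    if n: "1 \<le> n" and l: "bounded_label (n + k + N + 2) k l" for n l
  proof -
    define B where "B = n + k + N + 2"
    define t where "t = nat \<lceil>log 2 (real B)\<rceil>"
    have B: "2 \<le> B" by (simp add: B_def)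
    have "k + N + 2 \<le> n * (k + N + 2)" using mult_le_mono1[OF n, of "k + N + 2"] by simp
    then have BK: "B \<le> n * K" unfolding B_def K_def by (simp add: algebra_simps)
    have "log 2 (real B) \<le> real t" unfolding t_def by linarith
    then have "real B \<le> 2 ^ t" using B by (simp add: log_le_iff powr_realpow)
    then have "B \<le> 2 ^ t" by (metis of_nat_le_iff of_nat_numeral of_nat_power)
    then have "B ^ q \<le> 2 ^ (t * q)" by (metis power_mono power_mult zero_le)
    moreover have "label_code l < B ^ q" by (rule q[OF B]) (use l in \<open>simp only: B_def\<close>)
    ultimately have "length (encode l) \<le> t * q"
      unfolding encode_def by (intro length_bits_le) (rule order_less_le_trans)
    then have "real (length (encode l)) \<le> real q * real t" by (metis mult.commute of_nat_le_iff of_nat_mult)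
    also have "real t \<le> log 2 (real B) + 1"
      using B unfolding t_def by (simp add: of_nat_nat ceiling_correct less_imp_le)
    also have "log 2 (real B) \<le> log 2 (real n * real K)"
      using B BK n Kpos by (subst log_le_cancel_iff) (auto simp flip: of_nat_mult)
    also have "\<dots> = log 2 (real n) + log 2 (real K)" using n by (simp add: log_mult K_def)
    finally have "real (length (encode l)) \<le> real q * (log 2 (real n) + log 2 (real K) + 1)"
      by (simp add: mult_left_mono)
    also have "\<dots> = real q * log 2 (real n) + c" by (simp add: c_def algebra_simps)
    also have "real q * log 2 (real n) \<le> c * log 2 (real n)"
      using n logK by (intro mult_right_mono) (auto simp: c_def mult_le_cancel_left1)
    finally show ?thesis by simp
  qed
  then show ?thesis by blast
qed

section \<open>The verifier and the scheme\<close>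

text \<open>A view is a bare set of pairs; identifiers are distinct, so the own label is the one
  filed under \<open>i\<close> and the remaining pairs belong to the neighbours.\<close>

definition verifier :: "nat \<Rightarrow> (nat \<Rightarrow> nat set \<Rightarrow> nat set \<Rightarrow> nat set \<Rightarrow> (nat \<Rightarrow> nat) \<Rightarrow> nat) \<Rightarrow> (nat \<Rightarrow> bool)
    \<Rightarrow> nat \<times> (nat \<times> bool list) set \<Rightarrow> bool" where
  "verifier k f acc = (\<lambda>(i, X). accepts k f acc i (decode (THE l. (i, l) \<in> X))
     ((\<lambda>(j, l). (j, decode l)) ` {x \<in> X. fst x \<noteq> i}))"

lemma verifier_view:
  assumes g: "simple_graph V E" and \<iota>: "id_assignment V \<iota>" and v: "v \<in> V"
  shows "verifier k f acc (view V E \<iota> L v) \<longleftrightarrow>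
    accepts k f acc (\<iota> v) (decode (L v)) ((\<lambda>w. (\<iota> w, decode (L w))) ` {w. E v w})"
proof -
  have inj: "inj_on \<iota> V" using \<iota> by (auto simp: id_assignment_def bij_betw_def)
  have edge: "w \<in> V \<and> w \<noteq> v" if "E v w" for w using g that by (auto simp: simple_graph_def)
  have id_ne: "\<iota> w \<noteq> \<iota> v" if "E v w" for w using edge[OF that] inj_onD[OF inj, of w v] v by blast
  let ?X = "(\<lambda>w. (\<iota> w, L w)) ` closed_nbhd V E v"
  have "(THE l. (\<iota> v, l) \<in> ?X) = L v"
    using v inj by (intro the_equality) (auto simp: closed_nbhd_def dest: inj_onD)
  moreover have "{x \<in> ?X. fst x \<noteq> \<iota> v} = (\<lambda>w. (\<iota> w, L w)) ` {w. E v w}"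
    using edge id_ne by (auto simp: closed_nbhd_def)
  ultimately show ?thesis by (simp add: verifier_def view_def image_image)
qed

theorem theorem9:
  fixes \<omega> :: int and \<psi> :: mso
  assumes "mso_sentence \<psi>"
  shows "\<exists>(Prv :: 'v set \<Rightarrow> ('v \<Rightarrow> 'v \<Rightarrow> bool) \<Rightarrow> ('v \<Rightarrow> nat) \<Rightarrow> 'v \<Rightarrow> bool list) Ver.
           PLS_log (\<lambda>V E. connected_graph V E \<and> lv_treewidth_le V E \<omega> \<and> models V E \<psi>) Prv Ver"
proof (cases "\<omega> < 0")
  case True
  \<comment> \<open>The str of the root contains the root, so the width is never negative: the class
    is empty and rejecting everywhere is a valid scheme.\<close>
  have "\<not> lv_treewidth_le V E \<omega>" if g: "simple_graph V E" and con: "connected_graph V E"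
    for V :: "'v set" and E
  proof
    assume "lv_treewidth_le V E \<omega>"
    then obtain r p where w: "width_le V E r p \<omega>" "elimination_tree V E r p"
      using lv_treewidth_connected[OF g con] by blast
    then have "r \<in> V" by (simp add: elimination_tree_def rooted_tree_def)
    moreover have "finite (strv V E r p r)" using g by (simp add: strv_def simple_graph_def)
    then have "card (strv V E r p r) \<ge> 1" by (simp add: strv_def Suc_le_eq card_gt_0_iff)
    ultimately show False using w(1) True unfolding width_le_def by fastforce
  qed
  then have "PLS_log (\<lambda>(V :: 'v set) E. connected_graph V E \<and> lv_treewidth_le V E \<omega> \<and> models V E \<psi>)
      (\<lambda>_ _ _ _. []) (\<lambda>_. False)"
    unfolding PLS_log_def by (auto simp: simple_graph_def intro: exI[of _ 0])
  then show ?thesis by blast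
next
  case False
  define k where "k = nat \<omega>"
  have \<omega>: "\<omega> = int k" using False by (simp add: k_def)
  obtain N f acc where f: "\<And>c S m X g. f c S m X g < (N :: nat)"
    "\<And>c S m X g g'. (\<And>x. x \<in> X \<Longrightarrow> g x = g' x) \<Longrightarrow> f c S m X g = f c S m X g'"
    "\<And>(V :: 'v set) E \<kappa> r p d col a \<rho>. etree k V E \<kappa> r p d col a \<Longrightarrow>
        etree.run k V E \<kappa> r p col a f (\<lambda>_. {}) \<rho> \<Longrightarrow> acc (\<rho> (\<kappa> r)) \<longleftrightarrow> models V E \<psi>"
    by (rule mso_sentence_automaton[OF assms, of k]) blast
  define good where "good V E \<iota> \<Lambda> \<longleftrightarrow> (\<forall>v\<in>V. accepts k f acc (\<iota> v) (\<Lambda> v) ((\<lambda>w. (\<iota> w, \<Lambda> w)) ` {w. E v w}) \<and>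
    bounded_label (card V + k + N + 2) k (\<Lambda> v))" for V :: "'v set" and E \<iota> \<Lambda>
  define lab where "lab V E \<iota> = (SOME \<Lambda>. good V E \<iota> \<Lambda>)" for V :: "'v set" and E \<iota>
  let ?Cls = "\<lambda>(V :: 'v set) E. connected_graph V E \<and> lv_treewidth_le V E \<omega> \<and> models V E \<psi>"
  have good: "good V E \<iota> (lab V E \<iota>)"
    if g: "simple_graph V E" and cls: "?Cls V E" and \<iota>: "id_assignment V \<iota>" for V E \<iota>
  proof -
    have con: "connected_graph V E" using cls by blast
    obtain r p S where S: "elimination_tree V E r p" "width_le V E r p (int k)"
      "path_system V E S" "congestion_le V S (int k)" "witnesses V E S r p"
      using cls lv_treewidth_connected[OF g con] \<omega> by blast
    obtain d col a where e: "etree k V E \<iota> r p d col a" and a: "\<And>v c. a v c \<le> card V"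
      using etree_exists[OF g \<iota> S(1,2)] by blast
    obtain \<rho> where run: "etree.run k V E \<iota> r p col a f (\<lambda>_. {}) \<rho>"
      using etree.run_exists[OF e, of f "\<lambda>_. {}"] f(2) by blast
    have "acc (\<rho> (\<iota> r))" using f(3)[OF e run] cls by blast
    then have "\<exists>\<Lambda>. good V E \<iota> \<Lambda>"
      unfolding good_def by (rule accepted_labels_exist[OF g con \<iota> e a S(3-5) run _ f(1)])
    then show ?thesis unfolding lab_def by (rule someI_ex)
  qed
  have sound: "?Cls V E"
    if g: "simple_graph V E" and \<iota>: "id_assignment V \<iota>"
      and ver: "\<forall>v\<in>V. verifier k f acc (view V E \<iota> L v)" for V E \<iota> L
  proof -
    interpret accepted k f acc V E \<iota> "\<lambda>v. decode (L v)"
      by unfold_locales (use g \<iota> ver verifier_view[OF g \<iota>] in auto)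
    \<comment> \<open>The published states form the run on the certified tree, so acceptance at the
      root decides \<open>\<psi>\<close>.\<close>
    have "models V E \<psi>"
      using f(3)[OF etree_axioms run_labels[OF f(2)]] acc_root inv_into_f_f[OF inj root(1)] by simp
    then show ?thesis using connected lv_treewidth \<omega> by blast
  qed
  obtain c where c: "\<And>n l. 1 \<le> n \<Longrightarrow> bounded_label (n + k + N + 2) k l \<Longrightarrow>
     real (length (encode l)) \<le> c * log 2 (real n) + c"
    using encode_length by blast
  have "PLS_log ?Cls (\<lambda>V E \<iota> v. encode (lab V E \<iota> v)) (verifier k f acc)"
    unfolding PLS_log_def
  proof (intro conjI allI impI ballI)
    fix V :: "'v set" and E \<iota> v
    assume "simple_graph V E \<and> ?Cls V E \<and> id_assignment V \<iota>" and v: "v \<in> V"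
    then show "verifier k f acc (view V E \<iota> (\<lambda>v. encode (lab V E \<iota> v)) v)"
      using good[of V E \<iota>] by (simp add: verifier_view decode_encode good_def)
  next
    fix V :: "'v set" and E \<iota> L
    assume "simple_graph V E \<and> \<not> ?Cls V E \<and> id_assignment V \<iota>"
    then show "\<exists>v\<in>V. \<not> verifier k f acc (view V E \<iota> L v)" using sound by blast
  next
    show "\<exists>c::real. \<forall>V E ident. simple_graph V E \<and> ?Cls V E \<and> id_assignment V ident \<longrightarrow>
        (\<forall>v\<in>V. real (length (encode (lab V E ident v))) \<le> c * log 2 (real (card V)) + c)"
    proof (intro exI[of _ c] allI impI ballI)
      fix V :: "'v set" and E \<iota> v
      assume a: "simple_graph V E \<and> ?Cls V E \<and> id_assignment V \<iota>" and v: "v \<in> V"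
      then have "1 \<le> card V" by (auto simp: simple_graph_def Suc_le_eq card_gt_0_iff)
      then show "real (length (encode (lab V E \<iota> v))) \<le> c * log 2 (real (card V)) + c"
        using c good[of V E \<iota>] a v by (simp add: good_def)
    qed
  qed
  then show ?thesis by blast
qed

end
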